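(* Let $X$ be a projective toric stack over a field $\mathbf{k}$ with Cox ring $S$, graded by $A=\mathrm{Cl}(X)$, and let $P\subseteq S$ be a nondegenerate, homogeneous prime ideal with $Y\subseteq X$ the corresponding integral substack. Let $\mathcal{F}$ be a vector bundle on $Y$ and $M$ a submodule of the $A$-graded $S$-module given by $\bigoplus_{d\in\mathrm{Eff}(S)}H^0(Y,\mathcal{F}(d))$. (1) $\mathrm{Eff}(M)=\{a\in A:M_a\neq0\}$ contains a minimal element with respect to the partial ordering $a\ge a'\iff a-a'\in\mathrm{Eff}(S)$. (2) Let $a\in\mathrm{Eff}(M)$ be a minimal element. The $a$-strongly linear strand of the minimal free resolution of $M$ has length at most $\dim_{\mathbf{k}}(M_a)-1$.
   Context: Here a projective toric stack is the quotient stack $X=[(\mathrm{Spec}(S)\setminus V(B))/\mathrm{Hom}(A,\mathbb{G}_m)]$ arising from the Cox construction of a projective toric variety, where $S=\mathbf{k}[x_0,\dots,x_n]$ is the Cox ring, graded by the class group $A=\mathrm{Cl}(X)$, and $B$ is the irrelevant ideal. The $A$-grading on $S$ is positive: $S_{\mathbf 0}=\mathbf{k}$ and there is a homomorphism $\theta:A\to\mathbb{Z}$ with $\theta(\deg(x_i))>0$ for all $i$. For $d\in A$, $\mathcal{O}_X(d)$ is the line bundle on $X$ associated to the twist $S(d)$ (where $S(d)_b=S_{d+b}$), and $\mathcal{F}(d)=\mathcal{F}\otimes\mathcal{O}_X(d)|_Y$. A homogeneous ideal $I\subseteq S$ is nondegenerate if $I\subseteq(x_0,\dots,x_n)^2$.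 For an $A$-graded module $M$, $\mathrm{Eff}(M)=\{a\in A:M_a\neq0\}$; in particular $\mathrm{Eff}(S)=\{a\in A:S_a\neq0\}$. $E=\Lambda_{\mathbf{k}}(e_0,\dots,e_n)$ is the exterior algebra with $A\oplus\mathbb{Z}$-grading $\deg(e_i)=(-\deg(x_i);-1)$; the $\mathbb{Z}$-component is the auxiliary degree $\mathrm{aux}$. $E$-modules are $A\oplus\mathbb{Z}$-graded right modules, viewed also as left modules via $em=(-1)^{\mathrm{aux}(e)\mathrm{aux}(m)}me$. $\omega_E=\underline{\mathrm{Hom}}_{\mathbf{k}}(E,\mathbf{k})$ is the graded $\mathbf{k}$-dual of $E$, with $(fe)(e')=f(ee')$. For an $A$-graded $S$-module $M$, $\mathbf{R}(M)=\bigoplus_{a\in A}M_a\otimes_{\mathbf{k}}\omega_E(-a;0)$ with differential $\partial_{\mathbf{R}(M)}(m\otimes f)=\sum_{i=0}^n x_im\otimes e_if$, and $K_a(M)=\ker\big(M_a\otimes_{\mathbf{k}}\omega_E(-a;0)\xrightarrow{\partial_{\mathbf{R}(M)}}\mathbf{R}(M)\big)$. For an $E$-module $D$ (with trivial differential), $\mathbf{L}(D)$ is the complex of $A$-graded $S$-modules with $\mathbf{L}(D)_j=\bigoplus_{a\in A}S(-a)\otimes_{\mathbf{k}}D_{(a;j)}$ in homological degree $j$ and differential $s\otimes y\mapsto\sum_{i=0}^n x_is\otimes e_iy$. For $a$ a minimal element of $\mathrm{Eff}(M)$, the $a$-strongly linear strand of the minimal free resolution of $M$ is $\mathbf{L}(K_a(M))$.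 The length of a complex $L$ concentrated in nonnegative homological degrees is the largest $i$ with $L_i\neq0$.
   Formalization: M is assumed nonzero (part (1) fails for M = 0), and in part (2) P is assumed to generate a prime ideal over the algebraic closure of k (Y geometrically integral); over a general field the bound fails, e.g. k = R, Y = P^1_C in P^3_R, M = C[s,t]. *)

theory Defs
  imports
    "HOL-Analysis.Analysis"
    "HOL-Algebra.Algebraic_Closure_Type"
    "HOL-Library.Poly_Mapping"
    "HOL-Library.Function_Algebras"
    "HOL-Library.Extended_Nat"
begin

section \<open>Polynomials graded by an abelian group\<close>

text \<open>The polynomial ring over \<open>'k\<close> with one variable for every element of the finite type \<open>'n\<close>
  is the monoid algebra of the monoid of exponent vectors. The linear order on \<open>'n\<close> is only used
  for the signs in the exterior algebra.\<close>

type_synonym ('n, 'k) mpol = "('n \<Rightarrow>\<^sub>0 nat) \<Rightarrow>\<^sub>0 'k"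

definition Const :: "'k::comm_ring_1 \<Rightarrow> ('n::finite, 'k) mpol" where
  "Const c = Poly_Mapping.single 0 c"

definition Var :: "'n::finite \<Rightarrow> ('n, 'k::comm_ring_1) mpol" where
  "Var i = Poly_Mapping.single (Poly_Mapping.single i 1) 1"

text \<open>A grading is given by a homomorphism \<open>cl\<close> from the group of exponent vectors
  to the grading group.\<close>

definition mon_deg :: "(int^'n \<Rightarrow> 'a) \<Rightarrow> ('n::finite \<Rightarrow>\<^sub>0 nat) \<Rightarrow> 'a" where
  "mon_deg cl t = cl (\<chi> i. int (Poly_Mapping.lookup t i))"

definition var_deg :: "(int^'n \<Rightarrow> 'a) \<Rightarrow> 'n::finite \<Rightarrow> 'a" where
  "var_deg cl i = cl (axis i 1)"

definition S_comp :: "(int^'n \<Rightarrow> 'a) \<Rightarrow> 'a \<Rightarrow> ('n::finite, 'k::comm_ring_1) mpol set" where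
  "S_comp cl a = {p. \<forall>t \<in> Poly_Mapping.keys p. mon_deg cl t = a}"

definition homogeneous :: "(int^'n \<Rightarrow> 'a) \<Rightarrow> ('n::finite, 'k::comm_ring_1) mpol \<Rightarrow> bool" where
  "homogeneous cl p \<longleftrightarrow> (\<exists>a. p \<in> S_comp cl a)"

definition ideal_of :: "'r::comm_ring_1 set \<Rightarrow> 'r set" where
  "ideal_of G = Modules.module.span (*) G"

definition is_ideal :: "'r::comm_ring_1 set \<Rightarrow> bool" where
  "is_ideal I \<longleftrightarrow> Modules.module.subspace (*) I"

definition is_prime_ideal :: "'r::comm_ring_1 set \<Rightarrow> bool" where
  "is_prime_ideal I \<longleftrightarrow> is_ideal I \<and> I \<noteq> UNIV \<and> (\<forall>x y. x * y \<in> I \<longrightarrow> x \<in> I \<or> y \<in> I)"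

definition homogeneous_ideal ::
  "(int^'n \<Rightarrow> 'a) \<Rightarrow> ('n::finite, 'k::comm_ring_1) mpol set \<Rightarrow> bool" where
  "homogeneous_ideal cl I \<longleftrightarrow> is_ideal I \<and> I = ideal_of {p \<in> I. homogeneous cl p}"

definition nondegenerate :: "('n::finite, 'k::comm_ring_1) mpol set \<Rightarrow> bool" where
  "nondegenerate I \<longleftrightarrow> I \<subseteq> ideal_of {Var i * Var j | i j. True}"

text \<open>The ideal generated by \<open>I\<close> in the polynomial ring over the algebraic closure is prime,
  i.e. \<open>Spec (S/I)\<close> is geometrically integral. If \<open>'k\<close> is algebraically closed, this is just
  primality of \<open>I\<close>. Primality alone does not give the bound on the length of the strand: over the
  reals, map \<open>x\<^sub>0, x\<^sub>1, x\<^sub>2, x\<^sub>3\<close> to \<open>s, i s, t, i t\<close> in the complex polynomials in \<open>s, t\<close>. The kernel is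
  a nondegenerate homogeneous prime, and the complex polynomials are the section module of the
  structure sheaf; the piece of degree \<open>0\<close> has real dimension \<open>2\<close>, but the resolution is
  linear of length \<open>2\<close>.\<close>

definition geometrically_prime :: "('n::finite, 'k::field) mpol set \<Rightarrow> bool" where
  "geometrically_prime I \<longleftrightarrow>
     is_prime_ideal (ideal_of (Poly_Mapping.map (to_ac :: 'k \<Rightarrow> 'k alg_closure) ` I))"


section \<open>Projective toric stacks\<close>

text \<open>The projective toric variety is the one of a full-dimensional lattice polytope \<open>Q\<close>. Its fan is
  the inner normal fan of \<open>Q\<close>: the rays are the primitive inner normals \<open>u i\<close> of the facets, and
  the maximal cones correspond to the vertices \<open>v\<close>, the cone of \<open>v\<close> being spanned by
  the normals of the facets through \<open>v\<close>.\<close>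

definition facet_at :: "(real^'d) set \<Rightarrow> ('n \<Rightarrow> int^'d) \<Rightarrow> 'n \<Rightarrow> (real^'d::finite) set" where
  "facet_at Q u i =
     {x \<in> Q. \<forall>y \<in> Q. (\<chi> j. real_of_int (u i $ j)) \<bullet> x \<le> (\<chi> j. real_of_int (u i $ j)) \<bullet> y}"

definition lattice_polytope_with_normals ::
  "(real^'d::finite) set \<Rightarrow> ('n::finite \<Rightarrow> int^'d) \<Rightarrow> bool" where
  "lattice_polytope_with_normals Q u \<longleftrightarrow>
     polytope Q \<and> interior Q \<noteq> {} \<and>
     (\<forall>v. v extreme_point_of Q \<longrightarrow> (\<forall>j. v $ j \<in> \<int>)) \<and>
     (\<forall>i. u i \<noteq> 0 \<and> Gcd (range (\<lambda>j. u i $ j)) = 1) \<and>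
     bij_betw (facet_at Q u) UNIV {F. F facet_of Q}"

text \<open>The class group is the cokernel of the map sending a character \<open>m\<close> to its divisor
  \<open>(\<langle>m, u i\<rangle>)\<^sub>i\<close>; \<open>cl\<close> sends a torus-invariant divisor to its class.\<close>

definition class_group_map :: "('n::finite \<Rightarrow> int^'d::finite) \<Rightarrow> (int^'n \<Rightarrow> 'a::ab_group_add) \<Rightarrow> bool"
  where
  "class_group_map u cl \<longleftrightarrow>
     (\<forall>D D'. cl (D + D') = cl D + cl D') \<and> surj cl \<and>
     {D. cl D = 0} = range (\<lambda>m. \<chi> i. \<Sum>j\<in>UNIV. m $ j * u i $ j)"

definition projective_toric ::
  "(real^'d::finite) set \<Rightarrow> ('n::finite \<Rightarrow> int^'d) \<Rightarrow> (int^'n \<Rightarrow> 'a::ab_group_add) \<Rightarrow> bool" where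
  "projective_toric Q u cl \<longleftrightarrow> lattice_polytope_with_normals Q u \<and> class_group_map u cl"

definition irrelevant_ideal ::
  "(real^'d::finite) set \<Rightarrow> ('n::finite \<Rightarrow> int^'d) \<Rightarrow> ('n, 'k::comm_ring_1) mpol set" where
  "irrelevant_ideal Q u =
     ideal_of {(\<Prod>i \<in> {i. v \<notin> facet_at Q u i}. Var i) | v. v extreme_point_of Q}"


section \<open>Vector bundles on integral closed substacks\<close>

text \<open>Let \<open>G = Hom(A, G\<^sub>m)\<close> and \<open>Z = V(P) - V(B)\<close>, so that \<open>Y = [Z/G]\<close>. Sheaves on \<open>Y\<close> are
  \<open>G\<close>-equivariant sheaves on \<open>Z\<close>. A quasi-coherent sheaf on \<open>Z\<close> is given by its sections
  over the basic affine opens \<open>D(f) \<inter> V(P)\<close> with \<open>f \<in> B\<close>; the coordinate ring of this open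
  is the localization \<open>(S/P)\<^sub>f\<close>, and its modules are the \<open>S\<close>-modules killed by \<open>P\<close> on which
  \<open>f\<close> acts bijectively. When \<open>f\<close> is homogeneous, the open is \<open>G\<close>-stable, and the equivariant
  structure is a coaction of the group algebra of \<open>A\<close> on the sections, i.e. an \<open>A\<close>-grading.

  \<open>sec F f\<close> is the module of sections over \<open>D(f)\<close>; all of them are
  realized as submodules of one \<open>S\<close>-module \<open>'m\<close> (for an arbitrary family, take the direct sum).
  \<open>res F f g\<close> is restriction from \<open>D(f)\<close> to \<open>D(g)\<close> for \<open>f\<close> dividing \<open>g\<close>.\<close>

record ('s, 'a, 'm) esheaf =
  act :: "'s \<Rightarrow> 'm \<Rightarrow> 'm"
  sec :: "'s \<Rightarrow> 'm set"
  res :: "'s \<Rightarrow> 's \<Rightarrow> 'm \<Rightarrow> 'm"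
  gr :: "'s \<Rightarrow> 'a \<Rightarrow> 'm set"

definition qcoh_sheaf ::
  "('n::finite, 'k::field) mpol set \<Rightarrow> ('n, 'k) mpol set \<Rightarrow> (('n, 'k) mpol, 'a, 'm::ab_group_add) esheaf \<Rightarrow> bool"
  where
  "qcoh_sheaf B P F \<longleftrightarrow>
     Modules.module (act F) \<and>
     (\<forall>f\<in>B. Modules.module.subspace (act F) (sec F f) \<and>
        bij_betw (act F f) (sec F f) (sec F f) \<and>
        (\<forall>p\<in>P. \<forall>x\<in>sec F f. act F p x = 0)) \<and>
     (\<forall>f\<in>B. \<forall>g\<in>B. f dvd g \<longrightarrow>
        (\<forall>x\<in>sec F f. res F f g x \<in> sec F g) \<and>
        (\<forall>x\<in>sec F f. \<forall>y\<in>sec F f. res F f g (x + y) = res F f g x + res F f g y) \<and>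
        (\<forall>s. \<forall>x\<in>sec F f. res F f g (act F s x) = act F s (res F f g x)) \<and>
        \<comment> \<open>\<open>sec F g\<close> is the localization of \<open>sec F f\<close> at \<open>g\<close>\<close>
        (\<forall>y\<in>sec F g. \<exists>n. \<exists>x\<in>sec F f. act F (g ^ n) y = res F f g x) \<and>
        (\<forall>x\<in>sec F f. res F f g x = 0 \<longrightarrow> (\<exists>n. act F (g ^ n) x = 0))) \<and>
     (\<forall>f\<in>B. \<forall>x\<in>sec F f. res F f f x = x) \<and>
     (\<forall>f\<in>B. \<forall>g\<in>B. \<forall>h\<in>B. f dvd g \<longrightarrow> g dvd h \<longrightarrow>
        (\<forall>x\<in>sec F f. res F g h (res F f g x) = res F f h x))"

text \<open>\<open>Bs\<close> is a basis of the \<open>(S/P)\<^sub>f\<close>-module \<open>sec F f\<close>; since \<open>f\<close> acts bijectively,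
  denominators can be cleared.\<close>

definition free_basis ::
  "('n::finite, 'k::field) mpol set \<Rightarrow> (('n, 'k) mpol, 'a, 'm::ab_group_add) esheaf \<Rightarrow> ('n, 'k) mpol \<Rightarrow> 'm set \<Rightarrow> bool"
  where
  "free_basis P F f Bs \<longleftrightarrow>
     finite Bs \<and> Bs \<subseteq> sec F f \<and>
     (\<forall>y\<in>sec F f. \<exists>n c. act F (f ^ n) y = (\<Sum>x\<in>Bs. act F (c x) x)) \<and>
     (\<forall>c. (\<Sum>x\<in>Bs. act F (c x) x) = 0 \<longrightarrow> (\<forall>x\<in>Bs. \<exists>n. f ^ n * c x \<in> P))"

text \<open>The points of \<open>Z\<close> are the prime ideals containing \<open>P\<close> and not containing \<open>B\<close>.\<close>

definition locally_free ::
  "('n::finite, 'k::field) mpol set \<Rightarrow> ('n, 'k) mpol set \<Rightarrow> (('n, 'k) mpol, 'a, 'm::ab_group_add) esheaf \<Rightarrow> bool"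
  where
  "locally_free B P F \<longleftrightarrow>
     (\<forall>q. is_prime_ideal q \<and> P \<subseteq> q \<and> \<not> B \<subseteq> q \<longrightarrow> (\<exists>f \<in> B - q. \<exists>Bs. free_basis P F f Bs))"

definition internal_direct_sum :: "('a \<Rightarrow> 'm::ab_group_add set) \<Rightarrow> 'm set \<Rightarrow> bool" where
  "internal_direct_sum G V \<longleftrightarrow>
     (\<forall>a. 0 \<in> G a \<and> G a \<subseteq> V \<and> (\<forall>x\<in>G a. \<forall>y\<in>G a. x - y \<in> G a)) \<and>
     (\<forall>x\<in>V. \<exists>!h. finite {a. h a \<noteq> 0} \<and> (\<forall>a. h a \<in> G a) \<and> x = (\<Sum>a | h a \<noteq> 0. h a))"

definition equivariant ::
  "(int^'n \<Rightarrow> 'a) \<Rightarrow> ('n::finite, 'k::field) mpol set \<Rightarrow>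
     (('n, 'k) mpol, 'a::ab_group_add, 'm::ab_group_add) esheaf \<Rightarrow> bool"
  where
  "equivariant cl B F \<longleftrightarrow>
     (\<forall>f\<in>B. homogeneous cl f \<longrightarrow>
        internal_direct_sum (gr F f) (sec F f) \<and>
        (\<forall>b d. \<forall>s\<in>S_comp cl b. \<forall>x\<in>gr F f d. act F s x \<in> gr F f (b + d)) \<and>
        (\<forall>g\<in>B. homogeneous cl g \<longrightarrow> f dvd g \<longrightarrow> (\<forall>d. \<forall>x\<in>gr F f d. res F f g x \<in> gr F g d)))"

definition vector_bundle ::
  "(int^'n \<Rightarrow> 'a) \<Rightarrow> ('n::finite, 'k::field) mpol set \<Rightarrow> ('n, 'k) mpol set \<Rightarrow>
     (('n, 'k) mpol, 'a::ab_group_add, 'm::ab_group_add) esheaf \<Rightarrow> bool"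
  where
  "vector_bundle cl B P F \<longleftrightarrow> qcoh_sheaf B P F \<and> locally_free B P F \<and> equivariant cl B F"

text \<open>\<open>F(d) = F \<otimes> O(d)\<close>: the pullback of \<open>O(d)\<close> to \<open>Z\<close> is the structure sheaf with its grading
  shifted by \<open>S(d)\<^sub>b = S\<^bsub>d+b\<^esub>\<close>.\<close>

definition twist :: "'a::ab_group_add \<Rightarrow> ('s, 'a, 'm) esheaf \<Rightarrow> ('s, 'a, 'm) esheaf" where
  "twist d F = F\<lparr>gr := (\<lambda>f b. gr F f (d + b))\<rparr>"

text \<open>Global sections over \<open>Y = [Z/G]\<close> are the \<open>G\<close>-invariant, i.e. degree \<open>0\<close>, global sections over
  \<open>Z\<close>, given as compatible families of sections over the opens \<open>D(f)\<close> with \<open>f \<in> B\<close>.\<close>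

definition H0 ::
  "(int^'n \<Rightarrow> 'a) \<Rightarrow> ('n::finite, 'k::field) mpol set \<Rightarrow>
     (('n, 'k) mpol, 'a::ab_group_add, 'm::ab_group_add) esheaf \<Rightarrow> (('n, 'k) mpol \<Rightarrow> 'm) set"
  where
  "H0 cl B F =
     {s. (\<forall>f. f \<notin> B \<longrightarrow> s f = 0) \<and>
         (\<forall>f\<in>B. s f \<in> sec F f) \<and>
         (\<forall>f\<in>B. \<forall>g\<in>B. f dvd g \<longrightarrow> res F f g (s f) = s g) \<and>
         (\<forall>f\<in>B. homogeneous cl f \<longrightarrow> s f \<in> gr F f 0)}"

definition section_mult ::
  "('s, 'a, 'm) esheaf \<Rightarrow> 's \<Rightarrow> ('s \<Rightarrow> 'm) \<Rightarrow> 's \<Rightarrow> 'm" where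
  "section_mult F p s = (\<lambda>f. act F p (s f))"


section \<open>Graded modules\<close>

text \<open>An \<open>A\<close>-graded \<open>S\<close>-module is given by its family of graded pieces \<open>M a\<close>, all contained in
  a type \<open>'v\<close> on which \<open>S\<close> acts by \<open>smul\<close>; the module is the external direct sum of the
  pieces.\<close>

definition Eff :: "('a \<Rightarrow> 'v::zero set) \<Rightarrow> 'a set" where
  "Eff M = {a. M a \<noteq> {0}}"

definition EffS :: "'k::field itself \<Rightarrow> (int^'n::finite \<Rightarrow> 'a) \<Rightarrow> 'a set" where
  "EffS k cl = Eff (S_comp cl :: 'a \<Rightarrow> ('n, 'k) mpol set)"

definition section_module ::
  "(int^'n \<Rightarrow> 'a) \<Rightarrow> ('n::finite, 'k::field) mpol set \<Rightarrow>
     (('n, 'k) mpol, 'a::ab_group_add, 'm::ab_group_add) esheaf \<Rightarrow> 'a \<Rightarrow> (('n, 'k) mpol \<Rightarrow> 'm) set"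
  where
  "section_module cl B F d = (if d \<in> EffS TYPE('k) cl then H0 cl B (twist d F) else {0})"

definition graded_submodule ::
  "(int^'n \<Rightarrow> 'a) \<Rightarrow> (('n::finite, 'k::field) mpol \<Rightarrow> 'v \<Rightarrow> 'v) \<Rightarrow>
     ('a::ab_group_add \<Rightarrow> 'v::ab_group_add set) \<Rightarrow> ('a \<Rightarrow> 'v set) \<Rightarrow> bool"
  where
  "graded_submodule cl smul M N \<longleftrightarrow>
     (\<forall>a. M a \<subseteq> N a \<and> 0 \<in> M a \<and> (\<forall>x\<in>M a. \<forall>y\<in>M a. x + y \<in> M a)) \<and>
     (\<forall>a b. \<forall>p\<in>S_comp cl b. \<forall>x\<in>M a. smul p x \<in> M (b + a))"

definition minimal_in_Eff ::
  "'k::field itself \<Rightarrow> (int^'n::finite \<Rightarrow> 'a::ab_group_add) \<Rightarrow> ('a \<Rightarrow> 'v::zero set) \<Rightarrow> 'a \<Rightarrow> bool" where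
  "minimal_in_Eff k cl M a \<longleftrightarrow>
     a \<in> Eff M \<and> (\<forall>a'\<in>Eff M. a - a' \<in> EffS k cl \<longrightarrow> a' = a)"

definition kscale :: "(('n::finite, 'k::field) mpol \<Rightarrow> 'v \<Rightarrow> 'v) \<Rightarrow> 'k \<Rightarrow> 'v \<Rightarrow> 'v" where
  "kscale smul c = smul (Const c)"

text \<open>The dimension of a subspace, with value \<open>\<infinity>\<close> when it is not finite.\<close>

definition edim :: "('k::field \<Rightarrow> 'v::ab_group_add \<Rightarrow> 'v) \<Rightarrow> 'v set \<Rightarrow> enat" where
  "edim scl V =
     (if \<exists>Bs. finite Bs \<and> Bs \<subseteq> V \<and> V \<subseteq> Modules.module.span scl Bs
      then enat (vector_space.dim scl V) else \<infinity>)"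


section \<open>The exterior algebra and the functors R and L\<close>

text \<open>An element of \<open>E\<close> is the family of its coefficients with respect to the basis \<open>e\<^sub>I\<close>, the product
  of the \<open>e\<^sub>i\<close> with \<open>i \<in> I\<close> in increasing order.\<close>

type_synonym ('n, 'k) ext = "'n set \<Rightarrow> 'k"

definition ext_mult :: "('n::{finite,linorder}, 'k::field) ext \<Rightarrow> ('n, 'k) ext \<Rightarrow> ('n, 'k) ext" where
  "ext_mult x y =
     (\<lambda>K. \<Sum>I\<in>Pow K. (- 1) ^ card {(i, j). i \<in> I \<and> j \<in> K - I \<and> j < i} * x I * y (K - I))"

definition ext_gen :: "'n::{finite,linorder} \<Rightarrow> ('n, 'k::field) ext" where
  "ext_gen i = (\<lambda>I. if I = {i} then 1 else 0)"

definition ext_comp ::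
  "((int, 'n) vec \<Rightarrow> 'a::ab_group_add) \<Rightarrow> 'a \<Rightarrow> int \<Rightarrow> ('n::{finite,linorder}, 'k::field) ext set" where
  "ext_comp cl c j = {x. \<forall>I. x I \<noteq> 0 \<longrightarrow> c = - (\<Sum>i\<in>I. var_deg cl i) \<and> j = - int (card I)}"

text \<open>Since \<open>E\<close> is finite-dimensional, the tensor product of a vector space \<open>V\<close> with \<open>\<omega>\<^sub>E = Hom(E, k)\<close>
  is the space of linear maps from \<open>E\<close> to \<open>V\<close>, where \<open>v \<otimes> f\<close> is the map sending \<open>e\<close> to \<open>f e\<close>
  times \<open>v\<close>.\<close>

type_synonym ('n, 'k, 'v) omega = "('n, 'k) ext \<Rightarrow> 'v"

definition tensor_omega ::
  "('k::field \<Rightarrow> 'v::ab_group_add \<Rightarrow> 'v) \<Rightarrow> 'v set \<Rightarrow> ('n::{finite,linorder}, 'k, 'v) omega set" where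
  "tensor_omega scl V =
     {\<phi>. Vector_Spaces.linear (\<lambda>c x I. c * x I) scl \<phi> \<and> range \<phi> \<subseteq> V}"

text \<open>The piece of \<open>V \<otimes> \<omega>\<^sub>E(-a;0)\<close> in degree \<open>(b;j)\<close>: as a graded dual, a functional of degree \<open>(c;j)\<close>
  is nonzero on the piece of \<open>E\<close> of degree \<open>(-c;-j)\<close> only.\<close>

definition omega_comp ::
  "((int, 'n) vec \<Rightarrow> 'a::ab_group_add) \<Rightarrow> 'a \<Rightarrow> 'a \<Rightarrow> int \<Rightarrow>
     ('n::{finite,linorder}, 'k::field, 'v::ab_group_add) omega set" where
  "omega_comp cl a b j =
     {\<phi>. \<forall>c' j'. \<forall>x\<in>ext_comp cl c' j'. \<phi> x \<noteq> 0 \<longrightarrow> c' = - (b - a) \<and> j' = - j}"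

definition right_mult ::
  "('n::{finite,linorder}, 'k::field, 'v) omega \<Rightarrow> ('n, 'k) ext \<Rightarrow> ('n, 'k, 'v) omega" where
  "right_mult \<phi> e = (\<lambda>e'. \<phi> (ext_mult e e'))"

text \<open>\<open>aux_sign\<close> multiplies the component of auxiliary degree \<open>j\<close> by \<open>(-1)\<^sup>j\<close>. As \<open>e\<^sub>i\<close> has auxiliary
  degree \<open>-1\<close>, the rule \<open>e m = (-1)\<^bsup>aux(e) aux(m)\<^esup> m e\<close> gives left multiplication by \<open>e\<^sub>i\<close>.\<close>

definition aux_sign :: "('n::{finite,linorder}, 'k::field, 'v) omega \<Rightarrow> ('n, 'k, 'v) omega" where
  "aux_sign \<phi> = (\<lambda>e. \<phi> (\<lambda>I. (- 1) ^ card I * e I))"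

definition left_gen ::
  "'n::{finite,linorder} \<Rightarrow> ('n, 'k::field, 'v) omega \<Rightarrow> ('n, 'k, 'v) omega" where
  "left_gen i \<phi> = right_mult (aux_sign \<phi>) (ext_gen i)"

text \<open>Elements of \<open>R(M)\<close> are families indexed by \<open>A\<close>; the entry at \<open>b\<close> lies in \<open>M\<^sub>b \<otimes> \<omega>\<^sub>E(-b;0)\<close>.
  The summand of the differential for \<open>i\<close> maps the entry at \<open>b - deg x\<^sub>i\<close> to the entry at \<open>b\<close>.\<close>

definition R_diff ::
  "((int, 'n) vec \<Rightarrow> 'a::ab_group_add) \<Rightarrow> (('n::{finite,linorder}, 'k::field) mpol \<Rightarrow> 'v \<Rightarrow> 'v::ab_group_add) \<Rightarrow>
     ('a \<Rightarrow> ('n, 'k, 'v) omega) \<Rightarrow> 'a \<Rightarrow> ('n, 'k, 'v) omega" where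
  "R_diff cl smul \<Phi> = (\<lambda>b e. \<Sum>i\<in>UNIV. smul (Var i) (left_gen i (\<Phi> (b - var_deg cl i)) e))"

definition K_mod ::
  "((int, 'n) vec \<Rightarrow> 'a::ab_group_add) \<Rightarrow> (('n::{finite,linorder}, 'k::field) mpol \<Rightarrow> 'v \<Rightarrow> 'v::ab_group_add) \<Rightarrow>
     ('a \<Rightarrow> 'v set) \<Rightarrow> 'a \<Rightarrow> ('n, 'k, 'v) omega set" where
  "K_mod cl smul M a =
     {\<phi> \<in> tensor_omega (kscale smul) (M a).
        R_diff cl smul (\<lambda>b. if b = a then \<phi> else 0) = 0}"

definition K_comp ::
  "((int, 'n) vec \<Rightarrow> 'a::ab_group_add) \<Rightarrow> (('n::{finite,linorder}, 'k::field) mpol \<Rightarrow> 'v \<Rightarrow> 'v::ab_group_add) \<Rightarrow>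
     ('a \<Rightarrow> 'v set) \<Rightarrow> 'a \<Rightarrow> 'a \<Rightarrow> int \<Rightarrow> ('n, 'k, 'v) omega set" where
  "K_comp cl smul M a b j = K_mod cl smul M a \<inter> omega_comp cl a b j"

text \<open>A complex is its family of modules together with its differential.\<close>

type_synonym 'c chain_complex = "(int \<Rightarrow> 'c set) \<times> ('c \<Rightarrow> 'c)"

definition complex_length :: "'c::zero chain_complex \<Rightarrow> enat" where
  "complex_length C = (SUP j \<in> {j::nat. fst C (int j) \<noteq> {0}}. enat j)"

text \<open>For an \<open>E\<close>-module \<open>D\<close> with graded pieces \<open>D b j\<close> and left multiplications \<open>lmul i\<close> by \<open>e\<^sub>i\<close>:
  the tensor product of \<open>S(-b)\<close> with \<open>D b j\<close> consists of the polynomials with coefficients in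
  \<open>D b j\<close>, and the outer finitely supported function is the direct sum over \<open>b\<close>.\<close>

definition L_complex ::
  "((int, 'n) vec \<Rightarrow> 'a::ab_group_add) \<Rightarrow> ('n::{finite,linorder} \<Rightarrow> 'd \<Rightarrow> 'd) \<Rightarrow> ('a \<Rightarrow> int \<Rightarrow> 'd set) \<Rightarrow>
     ('a \<Rightarrow>\<^sub>0 ('n \<Rightarrow>\<^sub>0 nat) \<Rightarrow>\<^sub>0 'd::ab_group_add) chain_complex" where
  "L_complex cl lmul D =
     ((\<lambda>j. {z. \<forall>b t. Poly_Mapping.lookup (Poly_Mapping.lookup z b) t \<in> D b j}),
      (\<lambda>z. \<Sum>b\<in>Poly_Mapping.keys z. \<Sum>t\<in>Poly_Mapping.keys (Poly_Mapping.lookup z b). \<Sum>i\<in>UNIV.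
         Poly_Mapping.single (b - var_deg cl i)
           (Poly_Mapping.single (t + Poly_Mapping.single i 1)
              (lmul i (Poly_Mapping.lookup (Poly_Mapping.lookup z b) t)))))"

definition strongly_linear_strand ::
  "((int, 'n) vec \<Rightarrow> 'a::ab_group_add) \<Rightarrow> (('n::{finite,linorder}, 'k::field) mpol \<Rightarrow> 'v \<Rightarrow> 'v::ab_group_add) \<Rightarrow>
     ('a \<Rightarrow> 'v set) \<Rightarrow> 'a \<Rightarrow> ('a \<Rightarrow>\<^sub>0 ('n \<Rightarrow>\<^sub>0 nat) \<Rightarrow>\<^sub>0 ('n, 'k, 'v) omega) chain_complex" where
  "strongly_linear_strand cl smul M a = L_complex cl left_gen (K_comp cl smul M a)"

end

theory Submission
  imports Defs
begin

text \<open>For part (1), the inner normals of a full-dimensional polytope span the whole space as a cone,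
  so they satisfy a linear relation with positive coefficients. Its coefficients define a
  real-valued degree on the class group that is positive on the variables, so only finitely many
  elements of \<open>Eff S\<close> lie below a given one.

  Part (2) is Green's vanishing argument. Write an element of \<open>K\<^sub>a(M)\<close> of auxiliary degree \<open>j\<close> as
  \<open>\<Sum> u\<^sub>l \<otimes> w\<^sub>l\<close> with a basis \<open>(u\<^sub>l)\<close> of \<open>M\<^sub>a\<close> and forms \<open>w\<^sub>l\<close> of degree \<open>j\<close>. At a point \<open>c\<close> of the affine
  cone over \<open>Y\<close>, the contraction of \<open>\<Sum> u\<^sub>l(c) w\<^sub>l\<close> with \<open>c\<close> vanishes. For general \<open>c\<close> this is a
  nontrivial linear relation among the contractions of the \<open>w\<^sub>l\<close>, so contracting with \<open>c\<close> lowers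
  both the number of basis elements and the exterior degree by one. General points are available
  over the algebraic closure, where the ideal stays prime by assumption; as no linear form
  vanishes on the cone, a general contraction of a nonzero form of positive degree is nonzero.\<close>

section \<open>Polynomials, evaluation and ideals\<close>

text \<open>A section that vanishes on one \<open>D(f)\<close> with \<open>f \<notin> P\<close>
  vanishes everywhere. One open on which the bundle is free therefore suffices: there a section
  becomes, after multiplication by a power of \<open>f\<close>, a vector of polynomials modulo
  \<open>P\<close>, and linear independence over the base field is kept.

  The induction closes because contraction with a point produces forms with constant coefficients
  again, while only the sections are polynomial. The price is that the point must avoid a polynomial
  given in advance, so the points come from a form of the Nullstellensatz. It is proved by adjoining
  one variable at a time, with subrings of the polynomial ring and congruences modulo
  \<open>P\<close> in place of residue rings and their fractions.

  Two facts known over the base field must survive extension of scalars: independence of the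
  sections and absence of linear forms. Both are pulled back by one device: a linear functional on
  the closure, applied to coefficients, maps the extended ideal into \<open>P\<close>.\<close>

lemma poly_mapping_sum_single:
  "p = (\<Sum>t\<in>Poly_Mapping.keys p. Poly_Mapping.single t (Poly_Mapping.lookup p t))"
  by (rule poly_mapping_eqI) (auto simp: lookup_sum lookup_single when_def in_keys_iff)

lemma poly_mapping_add_single_induct [case_names zero add_single]:
  fixes p :: "'a \<Rightarrow>\<^sub>0 'b::comm_monoid_add"
  assumes "Q 0" and "\<And>p t c. Q p \<Longrightarrow> Q (p + Poly_Mapping.single t c)"
  shows "Q p"
proof -
  have "Q (\<Sum>t\<in>T. Poly_Mapping.single t (Poly_Mapping.lookup p t))" if "finite T" for T
    using that
  proof (induction T)
    case (insert t T)
    then show ?case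
      using assms(2)[of "\<Sum>t\<in>T. Poly_Mapping.single t (Poly_Mapping.lookup p t)" t]
      by (simp add: add.commute)
  qed (simp add: assms)
  then show ?thesis
    by (subst poly_mapping_sum_single) simp
qed

lemma lookup_map_zero:
  "f 0 = 0 \<Longrightarrow> Poly_Mapping.lookup (Poly_Mapping.map f p) t = f (Poly_Mapping.lookup p t)"
  by (simp add: Poly_Mapping.map.rep_eq when_def)

lemma poly_mapping_map_zero: "f 0 = 0 \<Longrightarrow> Poly_Mapping.map f 0 = 0"
  by (rule poly_mapping_eqI) (simp add: lookup_map_zero)

lemma poly_mapping_map_add:
  assumes "\<And>x y. f (x + y) = f x + f y" "f 0 = 0"
  shows "Poly_Mapping.map f (p + q) = Poly_Mapping.map f p + Poly_Mapping.map f q"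
  by (rule poly_mapping_eqI) (simp add: lookup_map_zero lookup_add assms)

lemma poly_mapping_map_sum:
  assumes "\<And>x y. f (x + y) = f x + f y" "f 0 = 0"
  shows "Poly_Mapping.map f (\<Sum>x\<in>Y. p x) = (\<Sum>x\<in>Y. Poly_Mapping.map f (p x))"
  by (rule poly_mapping_eqI) (simp add: lookup_map_zero lookup_sum assms sum_comp_morphism[of f, unfolded o_def, symmetric])

lemma poly_mapping_map_mult:
  fixes h :: "'b::comm_semiring_0 \<Rightarrow> 'c::comm_semiring_0"
    and p q :: "'m::comm_monoid_add \<Rightarrow>\<^sub>0 'b"
  assumes "\<And>x y. h (x + y) = h x + h y" "h 0 = 0" "\<And>x y. h (x * y) = h x * h y"
  shows "Poly_Mapping.map h (p * q) = Poly_Mapping.map h p * Poly_Mapping.map h q"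
proof (induction p rule: poly_mapping_add_single_induct)
  case zero
  show ?case by (simp add: poly_mapping_map_zero assms)
next
  case (add_single p t c)
  have "Poly_Mapping.map h (Poly_Mapping.single t c * q)
      = Poly_Mapping.map h (Poly_Mapping.single t c) * Poly_Mapping.map h q"
  proof (induction q rule: poly_mapping_add_single_induct)
    case zero
    show ?case by (simp add: poly_mapping_map_zero assms)
  next
    case (add_single q s d)
    then show ?case
      by (simp add: distrib_left poly_mapping_map_add assms mult_single)
  qed
  with add_single show ?case
    by (simp add: distrib_right poly_mapping_map_add assms)
qed

text \<open>With \<open>h\<close> the inclusion of a field into its closure and
  \<open>\<psi>\<close> linear over the small field, this is linearity of the coefficientwise
  \<open>\<psi>\<close> over the small polynomial ring.\<close>

lemma poly_mapping_map_semilinear_mult: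
  fixes h :: "'b::comm_semiring_0 \<Rightarrow> 'c::comm_semiring_0"
    and p :: "'m::comm_monoid_add \<Rightarrow>\<^sub>0 'c" and q :: "'m \<Rightarrow>\<^sub>0 'b"
  assumes "\<And>x y. h (x + y) = h x + h y" "h 0 = 0"
    and "\<And>x y. \<psi> (x + y) = \<psi> x + \<psi> y" "\<psi> 0 = 0" "\<And>x y. \<psi> (x * h y) = \<psi> x * y"
  shows "Poly_Mapping.map \<psi> (p * Poly_Mapping.map h q) = Poly_Mapping.map \<psi> p * q"
proof (induction p rule: poly_mapping_add_single_induct)
  case zero
  show ?case by (simp add: poly_mapping_map_zero assms)
next
  case (add_single p t c)
  have "Poly_Mapping.map \<psi> (Poly_Mapping.single t c * Poly_Mapping.map h q)
      = Poly_Mapping.map \<psi> (Poly_Mapping.single t c) * q"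
  proof (induction q rule: poly_mapping_add_single_induct)
    case zero
    show ?case by (simp add: poly_mapping_map_zero assms)
  next
    case (add_single q s d)
    then show ?case
      by (simp add: distrib_left poly_mapping_map_add assms mult_single)
  qed
  with add_single show ?case
    by (simp add: distrib_right poly_mapping_map_add assms)
qed

lemma Const_simps [simp]:
  "Const 0 = 0" "Const 1 = 1" "Const (x + y) = Const x + Const y"
  "Const (x * y) = Const x * Const y" "Const (- x) = - Const x" "Const (x - y) = Const x - Const y"
  by (simp_all add: Const_def single_add mult_single single_uminus single_diff)

lemma Const_sum: "Const (\<Sum>x\<in>Y. f x) = (\<Sum>x\<in>Y. Const (f x))"
  by (induction Y rule: infinite_finite_induct) auto

lemma map_Const: "f 0 = 0 \<Longrightarrow> Poly_Mapping.map f (Const c) = Const (f c)"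
  by (simp add: Const_def)

lemma map_Var: "f 0 = 0 \<Longrightarrow> f 1 = 1 \<Longrightarrow> Poly_Mapping.map f (Var i) = Var i"
  by (simp add: Var_def)

section \<open>Evaluation of polynomials at a point\<close>

definition ev :: "('n::finite \<Rightarrow> 'k::comm_ring_1) \<Rightarrow> ('n, 'k) mpol \<Rightarrow> 'k" where
  "ev c p = (\<Sum>t\<in>Poly_Mapping.keys p. Poly_Mapping.lookup p t * (\<Prod>i\<in>UNIV. c i ^ Poly_Mapping.lookup t i))"

lemma ev_superset:
  assumes "finite T" "Poly_Mapping.keys p \<subseteq> T"
  shows "ev c p = (\<Sum>t\<in>T. Poly_Mapping.lookup p t * (\<Prod>i\<in>UNIV. c i ^ Poly_Mapping.lookup t i))"
  unfolding ev_def using assms by (intro sum.mono_neutral_left) (auto simp: in_keys_iff)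

lemma ev_zero [simp]: "ev c 0 = 0"
  by (simp add: ev_def)

lemma ev_add [simp]: "ev c (p + q) = ev c p + ev c q"
proof -
  let ?T = "Poly_Mapping.keys p \<union> Poly_Mapping.keys q"
  have "Poly_Mapping.keys (p + q) \<subseteq> ?T" by (rule Poly_Mapping.keys_add)
  then show ?thesis
    by (simp add: ev_superset[of ?T] lookup_add distrib_right sum.distrib)
qed

lemma ev_single:
  "ev c (Poly_Mapping.single t a) = a * (\<Prod>i\<in>UNIV. c i ^ Poly_Mapping.lookup t i)"
  by (simp add: ev_superset[of "{t}"])

lemma ev_mult [simp]: "ev c (p * q) = ev c p * ev c q"
proof (induction p rule: poly_mapping_add_single_induct)
  case (add_single p t a)
  have "ev c (Poly_Mapping.single t a * q) = ev c (Poly_Mapping.single t a) * ev c q"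
    by (induction q rule: poly_mapping_add_single_induct)
      (simp_all add: distrib_left mult_single ev_single lookup_add power_add prod.distrib)
  with add_single show ?case by (simp add: distrib_right)
qed simp

lemma ev_Const [simp]: "ev c (Const a) = a"
  by (simp add: Const_def ev_single)

lemma ev_one [simp]: "ev c 1 = 1"
  using ev_Const[of c 1] by simp

lemma ev_Var [simp]: "ev c (Var i) = c i"
proof -
  have "(\<Prod>j\<in>UNIV. c j ^ (if i = j then Suc 0 else 0)) = c i"
    by (subst prod.remove[of _ i]) (auto intro!: prod.neutral)
  then show ?thesis by (simp add: Var_def ev_single lookup_single when_def)
qed

lemma ev_uminus [simp]: "ev c (- p) = - ev c p"
  by (metis add_eq_0_iff ev_add ev_zero add.right_inverse)

lemma ev_sum [simp]: "ev c (\<Sum>x\<in>Y. f x) = (\<Sum>x\<in>Y. ev c (f x))"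
  by (induction Y rule: infinite_finite_induct) auto

section \<open>Ideals and prime ideals through their closure properties\<close>

lemma module_mult: "Modules.module ((*) :: 'r::comm_ring_1 \<Rightarrow> 'r \<Rightarrow> 'r)"
  by unfold_locales (auto simp: algebra_simps)

lemma is_ideal_iff:
  "is_ideal I \<longleftrightarrow> 0 \<in> I \<and> (\<forall>x\<in>I. \<forall>y\<in>I. x + y \<in> I) \<and> (\<forall>c. \<forall>x\<in>I. c * x \<in> I)"
  by (auto simp: is_ideal_def module.subspace_def[OF module_mult])

lemma is_ideal_ideal_of: "is_ideal (ideal_of G)"
  unfolding is_ideal_def ideal_of_def by (rule module.subspace_span[OF module_mult])

lemma ideal_of_superset: "x \<in> G \<Longrightarrow> x \<in> ideal_of G"
  unfolding ideal_of_def by (rule module.span_base[OF module_mult])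

lemma ideal_of_induct [consumes 1, case_names zero step]:
  assumes "x \<in> ideal_of G" "Q 0" "\<And>c x y. x \<in> G \<Longrightarrow> Q y \<Longrightarrow> Q (c * x + y)"
  shows "Q x"
  using module.span_induct_alt[OF module_mult, of x G Q] assms unfolding ideal_of_def by blast

context
  fixes I :: "'r::comm_ring_1 set"
  assumes I: "is_ideal I"
begin

lemma ideal_zero: "0 \<in> I" and ideal_add: "x \<in> I \<Longrightarrow> y \<in> I \<Longrightarrow> x + y \<in> I"
  and ideal_mult_left: "x \<in> I \<Longrightarrow> c * x \<in> I"
  using I by (auto simp: is_ideal_iff)

lemma ideal_mult_right: "x \<in> I \<Longrightarrow> x * c \<in> I"
  using ideal_mult_left[of x c] by (simp add: mult.commute)

lemma ideal_uminus: "x \<in> I \<Longrightarrow> - x \<in> I"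
  using ideal_mult_left[of x "- 1"] by simp

lemma ideal_diff: "x \<in> I \<Longrightarrow> y \<in> I \<Longrightarrow> x - y \<in> I"
  using ideal_add[of x "- y"] ideal_uminus by simp

lemma ideal_sum: "(\<And>x. x \<in> Y \<Longrightarrow> f x \<in> I) \<Longrightarrow> (\<Sum>x\<in>Y. f x) \<in> I"
  by (induction Y rule: infinite_finite_induct) (auto intro: ideal_zero ideal_add)

end

context
  fixes P :: "'r::comm_ring_1 set"
  assumes P: "is_prime_ideal P"
begin

lemma prime_is_ideal: "is_ideal P"
  using P by (simp add: is_prime_ideal_def)

lemma prime_mult_iff: "x * y \<in> P \<longleftrightarrow> x \<in> P \<or> y \<in> P"
  using P ideal_mult_left[OF prime_is_ideal] ideal_mult_right[OF prime_is_ideal]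
  by (auto simp: is_prime_ideal_def)

lemma one_notin_prime: "1 \<notin> P"
proof
  assume "1 \<in> P"
  then have "x \<in> P" for x using ideal_mult_left[OF prime_is_ideal, of 1 x] by simp
  then show False using P by (auto simp: is_prime_ideal_def)
qed

lemma prime_power: "x ^ n \<in> P \<Longrightarrow> x \<in> P"
  by (induction n) (auto simp: prime_mult_iff one_notin_prime)

end

section \<open>Points of prime ideals over an algebraically closed field\<close>

text \<open>For a subring this is the polynomial ring over it; for an ideal \<open>P\<close>,
  membership says that the polynomial vanishes modulo \<open>P\<close>.\<close>

definition pcoeffs :: "'r set \<Rightarrow> 'r::comm_ring_1 poly set" where
  "pcoeffs A = {q. \<forall>i. Polynomial.coeff q i \<in> A}"

text \<open>Subrings are sets in one fixed ring, so that variables can be adjoined by induction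
  without a change of type.\<close>

definition is_subring :: "'r::comm_ring_1 set \<Rightarrow> bool" where
  "is_subring A \<longleftrightarrow> 1 \<in> A \<and> (\<forall>x\<in>A. \<forall>y\<in>A. x - y \<in> A \<and> x * y \<in> A)"

context
  fixes A :: "'r::comm_ring_1 set"
  assumes A: "is_subring A"
begin

lemma subring_one: "1 \<in> A" and subring_diff: "x \<in> A \<Longrightarrow> y \<in> A \<Longrightarrow> x - y \<in> A"
  and subring_mult: "x \<in> A \<Longrightarrow> y \<in> A \<Longrightarrow> x * y \<in> A"
  using A by (auto simp: is_subring_def)

lemma subring_zero: "0 \<in> A"
  using subring_diff[OF subring_one subring_one] by simp

lemma subring_uminus: "x \<in> A \<Longrightarrow> - x \<in> A"
  using subring_diff[OF subring_zero] by simp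

lemma subring_add: "x \<in> A \<Longrightarrow> y \<in> A \<Longrightarrow> x + y \<in> A"
  using subring_diff[of x "- y"] subring_uminus by simp

lemma subring_sum: "(\<And>x. x \<in> Y \<Longrightarrow> f x \<in> A) \<Longrightarrow> (\<Sum>x\<in>Y. f x) \<in> A"
  by (induction Y rule: infinite_finite_induct) (auto intro: subring_zero subring_add)

lemma subring_power: "x \<in> A \<Longrightarrow> x ^ n \<in> A"
  by (induction n) (auto intro: subring_one subring_mult)

end

context
  fixes A :: "'r::comm_ring_1 set"
  assumes A: "is_subring A"
begin

lemma pcoeffs_subring: "is_subring (pcoeffs A)"
  unfolding is_subring_def
proof (intro conjI ballI)
  show "1 \<in> pcoeffs A"
    by (simp add: pcoeffs_def coeff_1 subring_zero[OF A] subring_one[OF A])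
  fix p q assume pq: "p \<in> pcoeffs A" "q \<in> pcoeffs A"
  then show "p - q \<in> pcoeffs A"
    by (simp add: pcoeffs_def subring_diff[OF A])
  show "p * q \<in> pcoeffs A"
    using pq by (auto simp: pcoeffs_def coeff_mult intro!: subring_sum[OF A] subring_mult[OF A])
qed

lemma pcoeffs_smult: "a \<in> A \<Longrightarrow> q \<in> pcoeffs A \<Longrightarrow> Polynomial.smult a q \<in> pcoeffs A"
  by (auto simp: pcoeffs_def intro: subring_mult[OF A])

lemma pcoeffs_monom: "a \<in> A \<Longrightarrow> Polynomial.monom a n \<in> pcoeffs A"
  by (auto simp: pcoeffs_def intro: subring_zero[OF A])

text \<open>The leading coefficient of \<open>p\<close> need not be invertible, so each cancellation
  of a top term costs one more factor of it.\<close>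

lemma pseudo_division:
  assumes p: "p \<in> pcoeffs A" "0 < Polynomial.degree p" and q: "q \<in> pcoeffs A"
  shows "\<exists>N h s. h \<in> pcoeffs A \<and> s \<in> pcoeffs A \<and> Polynomial.smult (Polynomial.lead_coeff p ^ N) q = p * h + s \<and>
           Polynomial.degree s < Polynomial.degree p"
  using q
proof (induction "Polynomial.degree q" arbitrary: q rule: less_induct)
  case less
  let ?d = "Polynomial.degree p" and ?n = "Polynomial.degree q" and ?a = "Polynomial.lead_coeff p"
  note R = subring_diff[OF pcoeffs_subring] subring_mult[OF pcoeffs_subring] subring_add[OF pcoeffs_subring]
  have a: "?a \<in> A" using p by (simp add: pcoeffs_def)
  show ?case
  proof (cases "?n < ?d")
    case True
    then show ?thesis
      using less.prems subring_zero[OF pcoeffs_subring]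
      by (intro exI[of _ 0] exI[of _ 0] exI[of _ q]) simp
  next
    case False
    define m where "m = Polynomial.monom (Polynomial.lead_coeff q) (?n - ?d)"
    define q' where "q' = Polynomial.smult ?a q - p * m"
    have m: "m \<in> pcoeffs A"
      unfolding m_def using less.prems by (intro pcoeffs_monom) (simp add: pcoeffs_def)
    have q': "q' \<in> pcoeffs A"
      unfolding q'_def using less.prems p a m by (intro R pcoeffs_smult)
    have "Polynomial.degree (p * m) \<le> ?d + (?n - ?d)"
      using degree_mult_le[of p m] degree_monom_le[of "Polynomial.lead_coeff q" "?n - ?d"]
      unfolding m_def by linarith
    then have "Polynomial.degree q' \<le> ?n"
      unfolding q'_def using False by (intro degree_diff_le degree_smult_le) auto
    moreover have "Polynomial.coeff q' ?n = 0"
      using False coeff_monom_mult[of "Polynomial.lead_coeff q" "?n - ?d" p ?n]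
      by (simp add: q'_def m_def mult.commute)
    moreover have "Polynomial.degree q' \<noteq> ?n" if "q' \<noteq> 0"
      using that calculation(2) leading_coeff_0_iff[of q'] by metis
    \<comment> \<open>For \<open>q' = 0\<close> the degree is \<open>0\<close>, which lies below
      \<open>?n\<close> because \<open>p\<close> has positive degree.\<close>
    ultimately have "Polynomial.degree q' < ?n"
      using p False by (cases "q' = 0") (auto simp: le_less)
    from less.hyps[OF this q'] obtain N h s where h: "h \<in> pcoeffs A" "s \<in> pcoeffs A"
      "Polynomial.smult (?a ^ N) q' = p * h + s" "Polynomial.degree s < ?d" by blast
    have "Polynomial.smult (?a ^ Suc N) q = Polynomial.smult (?a ^ N) q' + Polynomial.smult (?a ^ N) (p * m)"
      by (simp add: q'_def smult_diff_right mult.commute)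
    also have "\<dots> = p * (h + Polynomial.smult (?a ^ N) m) + s"
      by (simp add: h(3) algebra_simps)
    finally show ?thesis
      using h m a by (metis R(3) pcoeffs_smult subring_power[OF A])
  qed
qed

end

text \<open>Dropping the coefficients in \<open>P\<close> makes the degree that of the reduction modulo \<open>P\<close>.\<close>

definition clean :: "'r set \<Rightarrow> 'r::comm_ring_1 poly \<Rightarrow> 'r poly" where
  "clean P = map_poly (\<lambda>a. if a \<in> P then 0 else a)"

lemma coeff_clean: "Polynomial.coeff (clean P q) i = (if Polynomial.coeff q i \<in> P then 0 else Polynomial.coeff q i)"
  by (simp add: clean_def coeff_map_poly)

lemma degree_clean: "Polynomial.degree (clean P q) \<le> Polynomial.degree q"
  by (rule degree_le) (simp add: coeff_clean coeff_eq_0)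

lemma clean_pcoeffs: "0 \<in> A \<Longrightarrow> q \<in> pcoeffs A \<Longrightarrow> clean P q \<in> pcoeffs A"
  by (simp add: pcoeffs_def coeff_clean)

lemma lead_coeff_clean:
  "clean P q \<noteq> 0 \<Longrightarrow> Polynomial.lead_coeff (clean P q) \<notin> P"
  using leading_coeff_neq_0[of "clean P q"] by (auto simp: coeff_clean split: if_splits)

lemma clean_eq_0: "0 \<in> P \<Longrightarrow> clean P q = 0 \<longleftrightarrow> q \<in> pcoeffs P"
  by (auto simp: poly_eq_iff coeff_clean pcoeffs_def)

lemma pcoeffs_poly: "is_ideal P \<Longrightarrow> q \<in> pcoeffs P \<Longrightarrow> poly q y \<in> P"
  by (auto simp: poly_altdef pcoeffs_def intro!: ideal_sum ideal_mult_right)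

lemma diff_clean_pcoeffs: "is_ideal P \<Longrightarrow> q - clean P q \<in> pcoeffs P"
  by (auto simp: pcoeffs_def coeff_clean ideal_zero)

text \<open>Over a finite field, \<open>1\<close> plus the product of all \<open>x - a\<close> would
  be a nonconstant polynomial without a root.\<close>

lemma infinite_alg_closed: "infinite (UNIV :: 'k::alg_closed_field set)"
proof
  assume fin: "finite (UNIV :: 'k set)"
  let ?p = "(\<Prod>a\<in>UNIV. [:- a, 1:]) :: 'k poly"
  have "Polynomial.degree ?p = card (UNIV :: 'k set)"
    by (subst degree_prod_sum_eq) auto
  then have "0 < Polynomial.degree (?p + [:1:])"
    using fin by (subst degree_add_eq_left) (auto simp: card_gt_0_iff)
  then obtain x where "poly (?p + [:1:]) x = 0"
    using alg_closed_imp_poly_has_root by blast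
  moreover have "poly ?p x = 0"
    using fin by (auto simp: poly_prod)
  ultimately show False by simp
qed

text \<open>Homomorphisms from \<open>A\<close> to an algebraically closed field extend to \<open>A[y]\<close> modulo \<open>P\<close>. If \<open>y\<close> is algebraic, \<open>u\<close>
  is the product of the leading coefficient of a polynomial of minimal degree vanishing at \<open>y\<close> modulo \<open>P\<close>, any
  root of which may serve as value of \<open>y\<close>, and of a multiple of \<open>g\<close> in \<open>A\<close> modulo \<open>P\<close>.\<close>

lemma extend_point:
  fixes A :: "'r::comm_ring_1 set" and y :: 'r
  assumes A: "is_subring A" and P: "is_prime_ideal P"
    and g: "g \<in> pcoeffs A" "poly g y \<notin> P"
  shows "\<exists>u\<in>A - P. \<forall>f :: 'r \<Rightarrow> 'k::alg_closed_field.
      (\<forall>a b. f (a + b) = f a + f b) \<longrightarrow> (\<forall>a b. f (a * b) = f a * f b) \<longrightarrow> (\<forall>a\<in>P \<inter> A. f a = 0) \<longrightarrow>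
      f u \<noteq> 0 \<longrightarrow>
      (\<exists>\<xi>. (\<forall>q\<in>pcoeffs A. poly q y \<in> P \<longrightarrow> poly (map_poly f q) \<xi> = 0) \<and> poly (map_poly f g) \<xi> \<noteq> 0)"
proof -
  note I = prime_is_ideal[OF P]
  note AR = subring_diff[OF pcoeffs_subring[OF A]] subring_mult[OF pcoeffs_subring[OF A]]
    subring_add[OF pcoeffs_subring[OF A]]
  note A0 = subring_zero[OF A]
  have cl: "poly q y - poly (clean P q) y \<in> P" for q
    using pcoeffs_poly[OF I diff_clean_pcoeffs[OF I], of q y] by simp
  have clP: "poly (clean P q) y \<in> P \<longleftrightarrow> poly q y \<in> P" for q
    using cl[of q] ideal_add[OF I, of "poly q y - poly (clean P q) y" "poly (clean P q) y"]
      ideal_diff[OF I, of "poly q y" "poly q y - poly (clean P q) y"] by auto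
  have f0: "f 0 = 0" if "\<forall>a b. f (a + b) = f a + (f b :: 'k)" for f :: "'r \<Rightarrow> 'k"
    using that by (metis add_0 add_cancel_left_left)
  have fadd: "map_poly f (p + q) = map_poly f p + map_poly f q"
    if "\<forall>a b. f (a + b) = f a + (f b :: 'k)" for f :: "'r \<Rightarrow> 'k" and p q
    using that f0[OF that] by (intro poly_eqI) (simp add: coeff_map_poly)
  have fmult: "map_poly f (p * q) = map_poly f p * map_poly f q"
    if "\<forall>a b. f (a + b) = f a + (f b :: 'k)" "\<forall>a b. f (a * b) = f a * f b" for f :: "'r \<Rightarrow> 'k" and p q
  proof (rule poly_eqI)
    fix n
    have "f (\<Sum>i\<in>Y. h i) = (\<Sum>i\<in>Y. f (h i))" for h :: "nat \<Rightarrow> 'r" and Y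
      by (induction Y rule: infinite_finite_induct) (simp_all add: f0[OF that(1)] that)
    then show "Polynomial.coeff (map_poly f (p * q)) n = Polynomial.coeff (map_poly f p * map_poly f q) n"
      by (simp add: coeff_map_poly f0[OF that(1)] coeff_mult that)
  qed
  show ?thesis
  proof (cases "\<forall>q\<in>pcoeffs A. poly q y \<in> P \<longrightarrow> q \<in> pcoeffs P")
    \<comment> \<open>Here \<open>y\<close> is transcendental modulo \<open>P\<close>. Nothing
      constrains its value, so any value off the finitely many roots of the image of
      \<open>g\<close> works; \<open>u\<close> is a coefficient that keeps this image
      nonzero.\<close>
    case True
    have "g \<notin> pcoeffs P" using g pcoeffs_poly[OF I] by blast
    then obtain k where k: "Polynomial.coeff g k \<notin> P" by (auto simp: pcoeffs_def)
    show ?thesis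
    proof (intro bexI[of _ "Polynomial.coeff g k"] allI impI)
      fix f :: "'r \<Rightarrow> 'k"
      assume f: "\<forall>a b. f (a + b) = f a + f b" "\<forall>a b. f (a * b) = f a * f b"
        "\<forall>a\<in>P \<inter> A. f a = 0" "f (Polynomial.coeff g k) \<noteq> 0"
      have "map_poly f g \<noteq> 0"
        using f(4) coeff_map_poly[of f g k] f0[OF f(1)] by auto
      then have "finite {\<xi>. poly (map_poly f g) \<xi> = 0}" by (rule poly_roots_finite)
      moreover have "infinite (UNIV :: 'k set)"
        by (rule infinite_alg_closed)
      ultimately obtain \<xi> where "poly (map_poly f g) \<xi> \<noteq> 0"
        using ex_new_if_finite by blast
      moreover have "map_poly f q = 0" if "q \<in> pcoeffs A" "poly q y \<in> P" for q
        using True that f(3) f0[OF f(1)] by (intro poly_eqI) (auto simp: coeff_map_poly pcoeffs_def)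
      ultimately show "\<exists>\<xi>. (\<forall>q\<in>pcoeffs A. poly q y \<in> P \<longrightarrow> poly (map_poly f q) \<xi> = 0) \<and>
          poly (map_poly f g) \<xi> \<noteq> 0" by auto
    qed (use g k in \<open>auto simp: pcoeffs_def\<close>)
  next
    case False
    then obtain q0 where q0: "q0 \<in> pcoeffs A" "poly q0 y \<in> P" "q0 \<notin> pcoeffs P" by blast
    \<comment> \<open>A leading coefficient outside \<open>P\<close> makes the degree equal to that
      of the reduction modulo \<open>P\<close>. \<open>clean\<close> turns any relation that is
      nontrivial modulo \<open>P\<close> into such a polynomial.\<close>
    define Q where "Q q \<longleftrightarrow> q \<in> pcoeffs A \<and> poly q y \<in> P \<and> Polynomial.lead_coeff q \<notin> P" for q
    have cleanQ: "Q (clean P q)" if "q \<in> pcoeffs A" "poly q y \<in> P" "q \<notin> pcoeffs P" for q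
      unfolding Q_def using that
      by (auto simp: clP clean_pcoeffs A0 lead_coeff_clean clean_eq_0 ideal_zero[OF I])
    obtain p where p: "Q p" and pmin: "\<And>q. Q q \<Longrightarrow> Polynomial.degree p \<le> Polynomial.degree q"
      using ex_has_least_nat[of Q "clean P q0" Polynomial.degree, OF cleanQ[OF q0]] by blast
    let ?d = "Polynomial.degree p" and ?a = "Polynomial.lead_coeff p"
    have small: "q \<in> pcoeffs P" if "q \<in> pcoeffs A" "poly q y \<in> P" "Polynomial.degree q < ?d" for q
      using pmin[OF cleanQ[OF that(1,2)]] degree_clean[of P q] that(3) by fastforce
    have pA: "p \<in> pcoeffs A" "poly p y \<in> P" "?a \<notin> P" "?a \<in> A"
      using p by (auto simp: Q_def pcoeffs_def)
    have d: "0 < ?d"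
    proof (rule ccontr)
      assume "\<not> 0 < ?d"
      then obtain a where "p = [:a:]" by (auto elim!: degree_eq_zeroE)
      then show False using pA by auto
    qed
    \<comment> \<open>Elements of \<open>J\<close> represent multiples of \<open>g\<close> at
      \<open>y\<close> modulo \<open>P\<close>. One of least degree will turn out to be constant:
      this is the multiple of \<open>g\<close> in \<open>A\<close> that enters
      \<open>u\<close>.\<close>
    define J where "J r \<longleftrightarrow> r \<in> pcoeffs A \<and> (\<exists>w\<in>pcoeffs A. poly r y - poly w y * poly g y \<in> P)" for r
    have Jclean: "J (clean P r)" if Jr: "J r" for r
    proof -
      obtain w where w: "w \<in> pcoeffs A" "poly r y - poly w y * poly g y \<in> P" using Jr by (auto simp: J_def)
      have "poly (clean P r) y - poly w y * poly g y
          = (poly r y - poly w y * poly g y) - (poly r y - poly (clean P r) y)" by simp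
      then have "poly (clean P r) y - poly w y * poly g y \<in> P"
        using ideal_diff[OF I w(2) cl[of r]] by simp
      then show ?thesis using Jr w by (auto simp: J_def clean_pcoeffs A0)
    qed
    have gy: "J g" using g subring_one[OF pcoeffs_subring[OF A]] ideal_zero[OF I]
      by (auto simp: J_def intro!: bexI[of _ 1])
    have "g \<notin> pcoeffs P" using g pcoeffs_poly[OF I] by blast
    then have "J (clean P g) \<and> Polynomial.lead_coeff (clean P g) \<notin> P"
      using Jclean[OF gy] lead_coeff_clean clean_eq_0 ideal_zero[OF I] by blast
    then obtain r where r: "J r" "Polynomial.lead_coeff r \<notin> P"
      and rmin: "\<And>q. J q \<Longrightarrow> Polynomial.lead_coeff q \<notin> P \<Longrightarrow> Polynomial.degree r \<le> Polynomial.degree q"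
      using ex_has_least_nat[of "\<lambda>r. J r \<and> Polynomial.lead_coeff r \<notin> P" "clean P g" Polynomial.degree] by blast
    let ?e = "Polynomial.degree r" and ?b = "Polynomial.lead_coeff r"
    obtain w where w: "w \<in> pcoeffs A" "poly r y - poly w y * poly g y \<in> P" and rA: "r \<in> pcoeffs A"
      using r by (auto simp: J_def)
    have bA: "?b \<in> A" using rA by (simp add: pcoeffs_def)
    have rsmall: "s \<in> pcoeffs P" if "J s" "Polynomial.degree s < ?e" for s
    proof (rule ccontr)
      assume "s \<notin> pcoeffs P"
      then have "Polynomial.lead_coeff (clean P s) \<notin> P"
        using lead_coeff_clean clean_eq_0 ideal_zero[OF I] by blast
      then show False using rmin[OF Jclean[OF that(1)]] degree_clean[of P s] that(2) by linarith
    qed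
    \<comment> \<open>The remainder of \<open>g\<close> by \<open>p\<close> lies in \<open>J\<close>
      and is nonzero at \<open>y\<close> modulo \<open>P\<close>, so \<open>r\<close> has smaller
      degree than \<open>p\<close>.\<close>
    have ed: "?e < ?d"
    proof -
      obtain N h s where h: "h \<in> pcoeffs A" "s \<in> pcoeffs A" "Polynomial.smult (?a ^ N) g = p * h + s"
        "Polynomial.degree s < ?d"
        using pseudo_division[OF A pA(1) d g(1)] by blast
      have sy: "poly s y = ?a ^ N * poly g y - poly p y * poly h y"
        using arg_cong[OF h(3), of "\<lambda>q. poly q y"] by (simp add: algebra_simps)
      have "poly s y - ?a ^ N * poly g y \<in> P"
        using ideal_uminus[OF I ideal_mult_right[OF I pA(2)]] by (simp add: sy)
      then have Js: "J s"
        using h pcoeffs_monom[OF A subring_power[OF A pA(4)], of N 0]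
        unfolding J_def by (auto intro!: bexI[of _ "Polynomial.monom (?a ^ N) 0"] simp: poly_monom)
      have "poly s y \<notin> P"
      proof
        assume "poly s y \<in> P"
        then have "?a ^ N * poly g y \<in> P"
          using ideal_add[OF I \<open>poly s y \<in> P\<close> ideal_mult_right[OF I pA(2), of "poly h y"]] by (simp add: sy)
        then show False using g pA(3) prime_power[OF P] by (auto simp: prime_mult_iff[OF P])
      qed
      then have "s \<notin> pcoeffs P" using pcoeffs_poly[OF I] by blast
      then show ?thesis using rsmall[OF Js] h(4) by fastforce
    qed
    have ry: "poly r y \<notin> P"
      using small[OF rA _ ed] r(2) by (auto simp: pcoeffs_def)
    \<comment> \<open>If \<open>r\<close> were not constant, the remainder of \<open>p\<close> by
      \<open>r\<close> would lie in \<open>J\<close> in degree below \<open>?e\<close>, hence vanish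
      modulo \<open>P\<close>. Then \<open>r * h\<close> is a multiple of \<open>p\<close> modulo
      \<open>P\<close>, and \<open>h\<close> vanishes at \<open>y\<close> since \<open>r\<close>
      does not. But \<open>h\<close> has smaller degree than \<open>p\<close> modulo
      \<open>P\<close>, against the choice of \<open>p\<close>.\<close>
    have "?e = 0"
    proof (rule ccontr)
      assume e: "?e \<noteq> 0"
      obtain N h s where h: "h \<in> pcoeffs A" "s \<in> pcoeffs A" "Polynomial.smult (?b ^ N) p = r * h + s"
        "Polynomial.degree s < ?e"
        using pseudo_division[OF A rA _ pA(1)] e by blast
      have sy: "poly s y = ?b ^ N * poly p y - poly r y * poly h y"
        using arg_cong[OF h(3), of "\<lambda>q. poly q y"] by (simp add: algebra_simps)
      have "poly s y - poly (- h * w) y * poly g y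
          = ?b ^ N * poly p y - poly h y * (poly r y - poly w y * poly g y)"
        by (simp add: sy algebra_simps)
      then have "poly s y - poly (- h * w) y * poly g y \<in> P"
        using ideal_diff[OF I ideal_mult_left[OF I pA(2)] ideal_mult_left[OF I w(2)]] by simp
      moreover have "- h * w \<in> pcoeffs A"
        using AR(2)[OF subring_uminus[OF pcoeffs_subring[OF A] h(1)] w(1)] .
      ultimately have "J s" using h(2) unfolding J_def by blast
      then have sP: "s \<in> pcoeffs P" using rsmall h(4) by blast
      have "poly r y * poly h y \<in> P"
        using ideal_diff[OF I ideal_mult_left[OF I pA(2), of "?b ^ N"] pcoeffs_poly[OF I sP, of y]] by (simp add: sy)
      then have hy: "poly h y \<in> P" using ry by (simp add: prime_mult_iff[OF P])
      have hP: "h \<in> pcoeffs P"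
      proof (rule ccontr)
        assume nh: "h \<notin> pcoeffs P"
        let ?h = "clean P h"
        have Qh: "Q ?h" using cleanQ[OF h(1) hy nh] .
        let ?i = "?e + Polynomial.degree ?h"
        have c1: "Polynomial.coeff (r * (h - ?h)) ?i \<in> P"
          unfolding coeff_mult using diff_clean_pcoeffs[OF I, of h]
          by (intro ideal_sum[OF I] ideal_mult_left[OF I]) (simp add: pcoeffs_def)
        have c2: "Polynomial.coeff (r * ?h) ?i \<notin> P"
          using Qh r(2) by (simp add: coeff_mult_degree_sum Q_def prime_mult_iff[OF P])
        have c3: "Polynomial.coeff s ?i \<in> P" using sP by (simp add: pcoeffs_def)
        have "r * ?h = Polynomial.smult (?b ^ N) p - r * (h - ?h) - s"
          unfolding h(3) right_diff_distrib by simp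
        then have "Polynomial.coeff (r * ?h) ?i = Polynomial.coeff (Polynomial.smult (?b ^ N) p) ?i
            - Polynomial.coeff (r * (h - ?h)) ?i - Polynomial.coeff s ?i"
          by (metis coeff_diff)
        then have "Polynomial.coeff (Polynomial.smult (?b ^ N) p) ?i \<noteq> 0"
          using ideal_diff[OF I ideal_diff[OF I ideal_zero[OF I] c1] c3] c2 by metis
        then have "Polynomial.coeff p ?i \<noteq> 0" by auto
        then have "?i \<le> ?d" by (rule le_degree)
        then show False using pmin[OF Qh] e by linarith
      qed
      have "Polynomial.coeff (Polynomial.smult (?b ^ N) p) ?d \<in> P"
        unfolding h(3) coeff_add coeff_mult using hP sP
        by (intro ideal_add[OF I] ideal_sum[OF I] ideal_mult_left[OF I]) (simp_all add: pcoeffs_def)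
      then show False using r(2) pA(3) prime_power[OF P] by (auto simp: prime_mult_iff[OF P])
    qed
    then have rb: "r = [:?b:]" by (auto elim!: degree_eq_zeroE)
    show ?thesis
    proof (intro bexI[of _ "?a * ?b"] allI impI)
      fix f :: "'r \<Rightarrow> 'k"
      assume f: "\<forall>a b. f (a + b) = f a + f b" "\<forall>a b. f (a * b) = f a * f b"
        "\<forall>a\<in>P \<inter> A. f a = 0" "f (?a * ?b) \<noteq> 0"
      note hom = f0[OF f(1)] fadd[OF f(1)] fmult[OF f(1,2)]
      have fab: "f ?a \<noteq> 0" "f ?b \<noteq> 0" using f(2,4) by auto
      have "Polynomial.degree (map_poly f p) = ?d"
        using fab by (intro antisym degree_le le_degree) (simp_all add: coeff_map_poly hom coeff_eq_0)
      then obtain \<xi> where \<xi>: "poly (map_poly f p) \<xi> = 0"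
        using alg_closed_imp_poly_has_root[of "map_poly f p"] d by auto
      have kill: "poly (map_poly f q) \<xi> = 0" if q: "q \<in> pcoeffs A" "poly q y \<in> P" for q
      proof -
        obtain N h s where h: "h \<in> pcoeffs A" "s \<in> pcoeffs A" "Polynomial.smult (?a ^ N) q = p * h + s"
          "Polynomial.degree s < ?d"
          using pseudo_division[OF A pA(1) d q(1)] by blast
        have sy: "poly s y = ?a ^ N * poly q y - poly p y * poly h y"
          using arg_cong[OF h(3), of "\<lambda>q. poly q y"] by (simp add: algebra_simps)
        have "poly s y \<in> P"
          unfolding sy by (intro ideal_diff[OF I] ideal_mult_left[OF I q(2)] ideal_mult_right[OF I pA(2)])
        then have "s \<in> pcoeffs P" using small h by blast
        then have "map_poly f s = 0"
          using h(2) f(3) hom(1) by (intro poly_eqI) (auto simp: coeff_map_poly pcoeffs_def)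
        moreover have "map_poly f ([:?a ^ N:] * q) = map_poly f (p * h + s)" using h(3) by simp
        ultimately have "map_poly f [:?a ^ N:] * map_poly f q = map_poly f p * map_poly f h"
          by (simp only: hom) simp
        then have "poly (map_poly f [:?a ^ N:]) \<xi> * poly (map_poly f q) \<xi> = 0"
          using \<xi> by (metis mult_zero_left poly_mult)
        moreover have "f (?a ^ N) \<noteq> 0"
        proof (induction N)
          case 0
          \<comment> \<open>That \<open>f\<close> preserves \<open>1\<close> is not given;
            \<open>f 1 \<noteq> 0\<close> comes from \<open>f ?a \<noteq> 0\<close>.\<close>
          have "f ?a = f 1 * f ?a" using f(2)[rule_format, of 1 ?a] by simp
          then show ?case using fab by auto
        qed (use f(2) fab in simp)
        ultimately show ?thesis by (simp add: map_poly_pCons hom(1))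
      qed
      \<comment> \<open>This relation at \<open>y\<close> passes to \<open>\<xi>\<close>. As
        \<open>r\<close> is the constant \<open>?b\<close>, it makes \<open>f ?b\<close> a multiple
        of the value of \<open>g\<close>, which is therefore nonzero.\<close>
      have "poly (r + - w * g) y \<in> P" using w(2) by simp
      moreover have "r + - w * g \<in> pcoeffs A"
        using AR(3)[OF rA AR(2)[OF subring_uminus[OF pcoeffs_subring[OF A] w(1)] g(1)]] .
      ultimately have "poly (map_poly f (r + - w * g)) \<xi> = 0" using kill by blast
      then have "poly (map_poly f r) \<xi> + poly (map_poly f (- w)) \<xi> * poly (map_poly f g) \<xi> = 0"
        by (simp only: hom poly_add poly_mult)
      moreover have "poly (map_poly f r) \<xi> = f ?b"
        by (subst rb) (simp add: map_poly_pCons hom(1))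
      ultimately have "poly (map_poly f g) \<xi> \<noteq> 0" using fab by auto
      then show "\<exists>\<xi>. (\<forall>q\<in>pcoeffs A. poly q y \<in> P \<longrightarrow> poly (map_poly f q) \<xi> = 0) \<and>
          poly (map_poly f g) \<xi> \<noteq> 0" using kill by blast
    qed (use pA r(2) bA subring_mult[OF A] in \<open>auto simp: prime_mult_iff[OF P]\<close>)
  qed
qed

section \<open>Adjoining one variable at a time\<close>

definition mpol_vars :: "'n set \<Rightarrow> ('n::finite, 'k::comm_ring_1) mpol set" where
  "mpol_vars V = {p. \<forall>t\<in>Poly_Mapping.keys p. Poly_Mapping.keys t \<subseteq> V}"

lemma mpol_vars_subring: "is_subring (mpol_vars V)"
  unfolding is_subring_def
proof (intro conjI ballI)
  show "1 \<in> mpol_vars V" by (simp add: mpol_vars_def)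
  fix p q :: "('a, 'b) mpol" assume pq: "p \<in> mpol_vars V" "q \<in> mpol_vars V"
  have "Poly_Mapping.keys (p - q) \<subseteq> Poly_Mapping.keys p \<union> Poly_Mapping.keys q"
    by (auto simp: in_keys_iff lookup_minus)
  with pq show "p - q \<in> mpol_vars V"
    by (auto simp: mpol_vars_def)
  show "p * q \<in> mpol_vars V"
    unfolding mpol_vars_def
  proof (intro CollectI ballI)
    fix t assume "t \<in> Poly_Mapping.keys (p * q)"
    then obtain r s where rs: "t = r + s" "r \<in> Poly_Mapping.keys p" "s \<in> Poly_Mapping.keys q"
      using Poly_Mapping.keys_mult[of p q] by auto
    have "Poly_Mapping.keys r \<subseteq> V" "Poly_Mapping.keys s \<subseteq> V"
      using pq rs(2,3) by (simp_all add: mpol_vars_def)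
    then show "Poly_Mapping.keys t \<subseteq> V"
      using Poly_Mapping.keys_add[of r s] rs(1) by blast
  qed
qed

lemma Var_power: "Var y ^ k = Poly_Mapping.single (Poly_Mapping.single y k) 1"
proof (induction k)
  case (Suc k)
  have "Poly_Mapping.single y 1 + Poly_Mapping.single y k = Poly_Mapping.single y (Suc k)"
    using single_add[of y 1 k] by simp
  then show ?case
    by (simp add: Suc.IH) (simp add: Var_def mult_single)
qed simp

lemma mpol_vars_insert:
  assumes "p \<in> mpol_vars (insert y V)"
  shows "\<exists>q\<in>pcoeffs (mpol_vars V). p = poly q (Var y)"
proof -
  \<comment> \<open>\<open>m t\<close> is \<open>t\<close> with the exponent of \<open>y\<close>
    removed; the terms are then collected by powers of \<open>Var y\<close>.\<close>
  define m where "m t = t - Poly_Mapping.single y (Poly_Mapping.lookup t y)" for t :: "'a \<Rightarrow>\<^sub>0 nat"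
  define q where "q = (\<Sum>t\<in>Poly_Mapping.keys p. Polynomial.monom
    (Poly_Mapping.single (m t) (Poly_Mapping.lookup p t)) (Poly_Mapping.lookup t y))"
  have m: "m t + Poly_Mapping.single y (Poly_Mapping.lookup t y) = t" for t
    by (rule poly_mapping_eqI) (simp add: m_def lookup_add lookup_minus lookup_single when_def)
  have "Poly_Mapping.keys (m t) \<subseteq> V" if t: "t \<in> Poly_Mapping.keys p" for t
  proof
    fix i assume "i \<in> Poly_Mapping.keys (m t)"
    then have "Poly_Mapping.lookup t i \<noteq> 0" "i \<noteq> y"
      by (auto simp: m_def in_keys_iff lookup_minus lookup_single when_def split: if_splits)
    then have "i \<in> Poly_Mapping.keys t" by (simp add: in_keys_iff)
    then show "i \<in> V" using assms t \<open>i \<noteq> y\<close> by (auto simp: mpol_vars_def)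
  qed
  then have "q \<in> pcoeffs (mpol_vars V)"
    unfolding q_def
    by (intro subring_sum[OF pcoeffs_subring[OF mpol_vars_subring]] pcoeffs_monom[OF mpol_vars_subring])
      (simp add: mpol_vars_def)
  moreover have "poly q (Var y) = p"
    using poly_mapping_sum_single[of p]
    by (simp add: q_def poly_sum poly_monom Var_power mult_single m)
  ultimately show ?thesis by blast
qed

lemma ev_cong:
  assumes "p \<in> mpol_vars V" "\<And>i. i \<in> V \<Longrightarrow> c i = d i"
  shows "ev c p = ev d p"
  unfolding ev_def
proof (intro sum.cong refl arg_cong2[of _ _ _ _ "(*)"] prod.cong)
  fix t i assume t: "t \<in> Poly_Mapping.keys p"
  show "c i ^ Poly_Mapping.lookup t i = d i ^ Poly_Mapping.lookup t i"
  proof (cases "i \<in> V")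
    case False
    then have "i \<notin> Poly_Mapping.keys t" using assms(1) t by (auto simp: mpol_vars_def)
    then show ?thesis by (simp add: in_keys_iff)
  qed (simp add: assms(2))
qed

lemma ev_poly: "ev c (poly q x) = poly (map_poly (ev c) q) (ev c x)"
  by (induction q) (simp_all add: map_poly_pCons)

text \<open>Restricting both \<open>P\<close> and \<open>g\<close> to the variables in
  \<open>V\<close> lets the induction fix one coordinate at a time. In the base case everything is
  constant, and \<open>P\<close> contains no nonzero constant.\<close>

lemma exists_point_vars:
  fixes P :: "('n::finite, 'k::alg_closed_field) mpol set"
  assumes P: "is_prime_ideal P" and "finite V"
  shows "\<forall>g\<in>mpol_vars V - P. \<exists>c. (\<forall>p\<in>P \<inter> mpol_vars V. ev c p = 0) \<and> ev c g \<noteq> 0"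
  using \<open>finite V\<close>
proof (induction V rule: finite_induct)
  case empty
  have const: "\<exists>a. p = Const a" if "p \<in> mpol_vars {}" for p :: "('n, 'k) mpol"
  proof -
    have "p = Const (Poly_Mapping.lookup p 0)"
      using that
      by (intro poly_mapping_eqI) (auto simp: Const_def lookup_single when_def mpol_vars_def in_keys_iff keys_eq_empty)
    then show ?thesis by blast
  qed
  have zero: "a = 0" if "Const a \<in> P" for a
  proof (rule ccontr)
    assume "a \<noteq> 0"
    then have "Const (inverse a) * Const a = (1 :: ('n, 'k) mpol)"
      by (metis Const_simps(2,4) left_inverse)
    then show False
      using one_notin_prime[OF P] ideal_mult_left[OF prime_is_ideal[OF P] that] by metis
  qed
  show ?case
  proof
    fix g assume g: "g \<in> mpol_vars {} - P"
    then obtain a where a: "g = Const a" using const by blast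
    then have "a \<noteq> 0" using g ideal_zero[OF prime_is_ideal[OF P]] by auto
    then show "\<exists>c. (\<forall>p\<in>P \<inter> mpol_vars {}. ev c p = 0) \<and> ev c g \<noteq> 0"
      using const zero a by fastforce
  qed
next
  case (insert y V)
  show ?case
  proof
    fix g assume g: "g \<in> mpol_vars (insert y V) - P"
    then obtain q where q: "q \<in> pcoeffs (mpol_vars V)" "g = poly q (Var y)"
      using mpol_vars_insert by blast
    \<comment> \<open>\<open>u\<close> carries what must be nonzero at a point in the variables
      \<open>V\<close> for a value of \<open>y\<close> to exist; the induction hypothesis is applied
      to \<open>u\<close> in place of \<open>g\<close>.\<close>
    obtain u where u: "u \<in> mpol_vars V - P" and ext: "\<And>f :: ('n, 'k) mpol \<Rightarrow> 'k.
      \<lbrakk>\<forall>a b. f (a + b) = f a + f b; \<forall>a b. f (a * b) = f a * f b; \<forall>a\<in>P \<inter> mpol_vars V. f a = 0;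
      f u \<noteq> 0\<rbrakk> \<Longrightarrow> \<exists>\<xi>. (\<forall>q\<in>pcoeffs (mpol_vars V). poly q (Var y) \<in> P \<longrightarrow> poly (map_poly f q) \<xi> = 0) \<and>
        poly (map_poly f q) \<xi> \<noteq> 0"
      using extend_point[OF mpol_vars_subring P q(1), of "Var y"] g q(2) by auto
    obtain c where c: "\<forall>p\<in>P \<inter> mpol_vars V. ev c p = 0" "ev c u \<noteq> 0"
      using insert.IH u by blast
    obtain \<xi> where \<xi>: "\<And>q. q \<in> pcoeffs (mpol_vars V) \<Longrightarrow> poly q (Var y) \<in> P \<Longrightarrow> poly (map_poly (ev c) q) \<xi> = 0"
      "poly (map_poly (ev c) q) \<xi> \<noteq> 0"
      using ext[of "ev c"] c by auto
    have ev_eq: "ev (c(y := \<xi>)) (poly r (Var y)) = poly (map_poly (ev c) r) \<xi>"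
      if "r \<in> pcoeffs (mpol_vars V)" for r
    proof -
      have "ev (c(y := \<xi>)) (Polynomial.coeff r i) = ev c (Polynomial.coeff r i)" for i
        using that insert.hyps(2) by (intro ev_cong[of _ V]) (auto simp: pcoeffs_def)
      then have "map_poly (ev (c(y := \<xi>))) r = map_poly (ev c) r"
        by (intro poly_eqI) (simp add: coeff_map_poly)
      then show ?thesis by (simp add: ev_poly)
    qed
    show "\<exists>c. (\<forall>p\<in>P \<inter> mpol_vars (insert y V). ev c p = 0) \<and> ev c g \<noteq> 0"
    proof (intro exI[of _ "c(y := \<xi>)"] conjI ballI)
      fix p assume p: "p \<in> P \<inter> mpol_vars (insert y V)"
      then obtain r where "r \<in> pcoeffs (mpol_vars V)" "p = poly r (Var y)"
        using mpol_vars_insert by blast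
      then show "ev (c(y := \<xi>)) p = 0" using ev_eq \<xi>(1) p by simp
    qed (use q ev_eq \<xi>(2) in simp)
  qed
qed

text \<open>Nullstellensatz for primes: contrapositively, \<open>P\<close> contains every polynomial
  vanishing at all zeros of \<open>P\<close>.\<close>

theorem exists_point:
  fixes P :: "('n::finite, 'k::alg_closed_field) mpol set"
  assumes "is_prime_ideal P" "g \<notin> P"
  obtains c where "\<And>p. p \<in> P \<Longrightarrow> ev c p = 0" "ev c g \<noteq> 0"
proof -
  have "\<exists>c. (\<forall>p\<in>P. ev c p = 0) \<and> ev c g \<noteq> 0"
    using exists_point_vars[OF assms(1), of UNIV] assms(2) by (simp add: mpol_vars_def)
  then show thesis using that by blast
qed

section \<open>Contraction of exterior forms\<close>

text \<open>For \<open>i \<notin> J\<close>, the sign in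
  \<open>e\<^sub>i e\<^sub>J = \<plusminus> e\<^sub>K\<close> with
  \<open>K = insert i J\<close>.\<close>

definition shuffle_sign :: "'n::linorder \<Rightarrow> 'n set \<Rightarrow> 'r::comm_ring_1" where
  "shuffle_sign i J = (- 1) ^ card {j \<in> J. j < i}"

text \<open>The transpose of left multiplication by \<open>\<Sum> c\<^sub>i e\<^sub>i\<close>. A
  general ring of coefficients covers both a point \<open>c\<close> and the generic point
  \<open>Var\<close>.\<close>

definition contraction ::
  "('n::{finite,linorder} \<Rightarrow> 'r::comm_ring_1) \<Rightarrow> ('n set \<Rightarrow> 'r) \<Rightarrow> 'n set \<Rightarrow> 'r" where
  "contraction c w J = (\<Sum>i\<in>- J. shuffle_sign i J * c i * w (insert i J))"

lemma shuffle_sign_insert: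
  fixes J :: "'n::{finite,linorder} set"
  assumes "i \<notin> J"
  shows "shuffle_sign k (insert i J) = (if i < k then - shuffle_sign k J else shuffle_sign k J :: 'r::comm_ring_1)"
proof -
  have "{j \<in> insert i J. j < k} = (if i < k then insert i {j \<in> J. j < k} else {j \<in> J. j < k})"
    by auto
  then show ?thesis using assms by (simp add: shuffle_sign_def)
qed

lemma shuffle_sign_swap:
  fixes J :: "'n::{finite,linorder} set"
  assumes "i \<notin> J" "k \<notin> J" "i \<noteq> k"
  shows "shuffle_sign i J * shuffle_sign k (insert i J)
    = - (shuffle_sign k J * shuffle_sign i (insert k J) :: 'r::comm_ring_1)"
  using assms by (cases i k rule: linorder_cases) (simp_all add: shuffle_sign_insert)

text \<open>Both sides add two indices to \<open>J\<close>; exchanging the order in which they are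
  added reverses the sign.\<close>

lemma contraction_anticommute:
  fixes a b :: "'n::{finite,linorder} \<Rightarrow> 'r::comm_ring_1"
  shows
  "contraction a (contraction b w) J = - contraction b (contraction a w) J"
proof -
  define T where "T a b i k = (if k = i then 0 else
    shuffle_sign i J * shuffle_sign k (insert i J) * (a i * b k * w (insert i (insert k J))))" for a b :: "'n \<Rightarrow> 'r" and i k
  have expand: "contraction a (contraction b w) J = (\<Sum>i\<in>-J. \<Sum>k\<in>-J. T a b i k)" for a b
    unfolding contraction_def
  proof (rule sum.cong)
    fix i assume i: "i \<in> - J"
    have "(\<Sum>k\<in>- insert i J. shuffle_sign k (insert i J) * b k * w (insert k (insert i J)))
        * (shuffle_sign i J * a i) = (\<Sum>k\<in>- insert i J. T a b i k)"
      unfolding sum_distrib_right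
      by (intro sum.cong) (auto simp: T_def insert_commute algebra_simps)
    also have "\<dots> = (\<Sum>k\<in>-J. T a b i k)"
      by (intro sum.mono_neutral_left) (auto simp: T_def)
    finally show "shuffle_sign i J * a i * (\<Sum>k\<in>- insert i J. shuffle_sign k (insert i J) * b k * w (insert k (insert i J)))
       = (\<Sum>k\<in>-J. T a b i k)" by (simp add: mult.commute)
  qed simp
  have "T a b i k = - T b a k i" if "i \<in> - J" "k \<in> - J" for i k
    using that shuffle_sign_swap[of i J k, where 'r='r]
    by (auto simp: T_def insert_commute mult.commute)
  then have "(\<Sum>i\<in>-J. \<Sum>k\<in>-J. T a b i k) = (\<Sum>i\<in>-J. \<Sum>k\<in>-J. - T b a k i)"
    by (intro sum.cong refl) auto
  also have "\<dots> = - (\<Sum>k\<in>-J. \<Sum>i\<in>-J. T b a k i)"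
    by (subst sum.swap) (simp add: sum_negf)
  finally show ?thesis by (simp add: expand)
qed

lemma contraction_sum: "contraction c (\<lambda>I. \<Sum>l\<in>L. w l I) J = (\<Sum>l\<in>L. contraction c (w l) J)"
  unfolding contraction_def sum_distrib_left by (rule sum.swap)

lemma contraction_mult_right: "contraction c (\<lambda>I. w I * a) J = contraction c w J * a"
  by (simp add: contraction_def sum_distrib_right mult.assoc)

lemma contraction_ideal:
  "is_ideal I \<Longrightarrow> (\<And>J. w J \<in> I) \<Longrightarrow> contraction c w J \<in> I"
  unfolding contraction_def by (intro ideal_sum ideal_mult_left)

text \<open>Serves for evaluation at a point, for constants as polynomials and for extension of
  scalars.\<close>

lemma contraction_hom:
  fixes f :: "'r::comm_ring_1 \<Rightarrow> 's::comm_ring_1" and c :: "'n::{finite,linorder} \<Rightarrow> 'r"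
  assumes "\<And>x y. f (x + y) = f x + f y" "\<And>x y. f (x * y) = f x * f y" "f 1 = 1" "f 0 = 0"
  shows "f (contraction c w J) = contraction (\<lambda>i. f (c i)) (\<lambda>I. f (w I)) J"
proof -
  have "f (- 1) + 1 = 0" using assms(1)[of "- 1" 1] assms(3,4) by simp
  then have "f (- 1) = - 1" by (simp add: eq_neg_iff_add_eq_0)
  then have "f ((- 1) ^ n) = (- 1) ^ n" for n
    by (induction n) (simp_all add: assms(2,3) del: mult_minus1 mult_minus_left)
  then have "f (shuffle_sign i J) = shuffle_sign i J" for i
    by (simp add: shuffle_sign_def)
  moreover have "f (\<Sum>x\<in>Y. g x) = (\<Sum>x\<in>Y. f (g x))" for g :: "'n \<Rightarrow> 'r" and Y
    by (induction Y rule: infinite_finite_induct) (simp_all add: assms)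
  ultimately show ?thesis by (simp add: contraction_def assms(2))
qed

text \<open>\<open>h l\<close> are the coordinates of the \<open>l\<close>-th section in a local frame \<open>Bs\<close>. The induction step contracts
  with a general point \<open>c\<close> and eliminates the section \<open>l\<close> through the relation at \<open>c\<close>.\<close>

lemma contraction_vanishing:
  fixes P :: "('n::{finite,linorder}, 'k::alg_closed_field) mpol set"
    and h :: "'l \<Rightarrow> 'b \<Rightarrow> ('n, 'k) mpol" and w :: "'l \<Rightarrow> 'n set \<Rightarrow> 'k"
  assumes P: "is_prime_ideal P"
    and lin: "\<And>\<nu>. (\<Sum>i\<in>UNIV. Const (\<nu> i) * Var i) \<in> P \<Longrightarrow> \<nu> = (\<lambda>_. 0)"
    and "finite L"
    and "\<And>\<mu>. (\<And>b. b \<in> Bs \<Longrightarrow> (\<Sum>l\<in>L. Const (\<mu> l) * h l b) \<in> P) \<Longrightarrow> \<forall>l\<in>L. \<mu> l = 0"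
    and "\<And>l I. l \<in> L \<Longrightarrow> w l I \<noteq> 0 \<Longrightarrow> card L \<le> card I"
    and "\<And>b J. b \<in> Bs \<Longrightarrow> contraction Var (\<lambda>I. \<Sum>l\<in>L. Const (w l I) * h l b) J \<in> P"
    and "l \<in> L"
  shows "w l I = 0"
  using assms(3-)
proof (induction "card L" arbitrary: L h w l I)
  case (Suc m)
  note I = prime_is_ideal[OF P]
  note fin = \<open>finite L\<close> and ind = Suc.prems(2) and supp = Suc.prems(3) and rel = Suc.prems(4)
    and l = \<open>l \<in> L\<close>
  show ?case
  proof (rule ccontr)
    assume nz: "w l I \<noteq> 0"
    have "I \<noteq> {}" using supp[OF l nz] Suc.hyps(2) by auto
    then obtain i where i: "i \<in> I" by auto
    define J where "J = I - {i}"
    \<comment> \<open>\<open>g\<close> is the \<open>J\<close>-coefficient of the contraction of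
      \<open>w l\<close> with a variable point, a linear form in that point. Its coefficient at
      \<open>i\<close> is \<open>w l I\<close> up to sign, so it is not in \<open>P\<close>.\<close>
    define \<nu> where "\<nu> k = (if k \<in> J then 0 else shuffle_sign k J * w l (insert k J))" for k
    define g where "g = (\<Sum>k\<in>UNIV. Const (\<nu> k) * Var k)"
    have "\<nu> i \<noteq> 0"
      using i nz by (simp add: \<nu>_def J_def insert_absorb shuffle_sign_def)
    then have g: "g \<notin> P" using lin[of \<nu>] by (auto simp: g_def)
    have ev_g: "ev c g = contraction c (w l) J" for c
    proof -
      have "ev c g = (\<Sum>k\<in>UNIV. \<nu> k * c k)" by (simp add: g_def)
      also have "\<dots> = (\<Sum>k\<in>-J. \<nu> k * c k)"
        by (intro sum.mono_neutral_right) (auto simp: \<nu>_def)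
      also have "\<dots> = contraction c (w l) J"
        unfolding contraction_def by (intro sum.cong) (auto simp: \<nu>_def)
      finally show ?thesis .
    qed
    obtain b0 where b0: "b0 \<in> Bs" "h l b0 \<notin> P"
    proof -
      have "(\<Sum>l'\<in>L. Const (if l' = l then 1 else 0) * h l' b) = h l b" for b
        using fin l by (subst sum.remove[of _ l]) (auto intro!: sum.neutral)
      then show thesis using ind[of "\<lambda>l'. if l' = l then 1 else 0"] that l by fastforce
    qed
    \<comment> \<open>Primality allows one point at which neither factor vanishes.\<close>
    have "g * h l b0 \<notin> P" using g b0 by (simp add: prime_mult_iff[OF P])
    then obtain c where c: "\<And>p. p \<in> P \<Longrightarrow> ev c p = 0" "ev c (g * h l b0) \<noteq> 0"
      using exists_point[OF P] by blast
    define v where "v l = ev c (h l b0)" for l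
    define w' where "w' l = contraction c (w l)" for l
    have vl: "v l \<noteq> 0" and w'l: "w' l J \<noteq> 0"
      using c(2) ev_g[of c] by (auto simp: v_def w'_def)
    let ?L = "L - {l}"
    have L_split: "(\<Sum>l'\<in>L. f l') = f l + (\<Sum>l'\<in>?L. f l')" for f :: "'l \<Rightarrow> 'r::comm_monoid_add"
      using fin l by (rule sum.remove)
    have key: "(\<Sum>l'\<in>L. w' l' J * v l') = 0" for J
    proof -
      have "0 = ev c (contraction Var (\<lambda>I. \<Sum>l\<in>L. Const (w l I) * h l b0) J)"
        using c(1)[OF rel[OF b0(1)]] by simp
      also have "\<dots> = contraction c (\<lambda>I. \<Sum>l\<in>L. w l I * v l) J"
        by (subst contraction_hom) (simp_all add: v_def)
      also have "\<dots> = (\<Sum>l'\<in>L. w' l' J * v l')"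
        by (simp add: contraction_sum contraction_mult_right w'_def)
      finally show ?thesis by simp
    qed
    \<comment> \<open>The new sections vanish at \<open>c\<close> in the coordinate
      \<open>b0\<close>. By \<open>key\<close>, \<open>w' l\<close> is determined by the other forms
      exactly so that replacing \<open>h\<close> by \<open>h'\<close> and dropping \<open>l\<close>
      leaves the sum of the products with \<open>w'\<close> unchanged.\<close>
    define h' where "h' l' b = h l' b - Const (v l' / v l) * h l b" for l' b
    have h'_sum: "(\<Sum>l'\<in>?L. Const (\<mu> l') * h' l' b) =
      (\<Sum>l'\<in>L. Const (if l' = l then - (\<Sum>l'\<in>?L. \<mu> l' * v l') / v l else \<mu> l') * h l' b)" for \<mu> b
    proof -
      have "(\<Sum>l'\<in>?L. Const (\<mu> l') * h' l' b) = (\<Sum>l'\<in>?L. Const (\<mu> l') * h l' b)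
          - Const ((\<Sum>l'\<in>?L. \<mu> l' * v l') / v l) * h l b"
        unfolding h'_def right_diff_distrib sum_subtractf
        by (simp add: sum_divide_distrib Const_sum sum_distrib_right flip: mult.assoc Const_simps(4))
      also have "\<dots> = (\<Sum>l'\<in>L. Const (if l' = l then - (\<Sum>l'\<in>?L. \<mu> l' * v l') / v l else \<mu> l') * h l' b)"
        by (subst L_split) (simp add: algebra_simps)
      finally show ?thesis .
    qed
    have w'0: "w' l' K = 0" if l': "l' \<in> ?L" for l' K
    proof (rule Suc.hyps(1)[where h = h' and L = ?L])
      show "m = card ?L" using Suc.hyps(2) fin l by simp
      show "finite ?L" using fin by simp
      show "\<forall>l'\<in>?L. \<mu> l' = 0" if \<mu>: "\<And>b. b \<in> Bs \<Longrightarrow> (\<Sum>l'\<in>?L. Const (\<mu> l') * h' l' b) \<in> P" for \<mu>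
      proof
        fix l' assume l': "l' \<in> ?L"
        then show "\<mu> l' = 0"
          using ind[OF \<mu>[unfolded h'_sum], THEN bspec, of l'] by (auto split: if_splits)
      qed
      show "card ?L \<le> card K" if "l' \<in> ?L" "w' l' K \<noteq> 0" for l' K
      proof -
        obtain k where k: "k \<in> - K" "w l' (insert k K) \<noteq> 0"
          using \<open>w' l' K \<noteq> 0\<close> unfolding w'_def contraction_def
          by (auto elim!: sum.not_neutral_contains_not_neutral)
        then have "card L \<le> Suc (card K)"
          using supp[of l' "insert k K"] that by auto
        then show ?thesis using fin l by simp
      qed
      \<comment> \<open>The new sum is the contraction of the old one with \<open>c\<close>.
        Anticommuting moves the contraction with \<open>Var\<close> inside, where the old relation
        places it in \<open>P\<close>.\<close>
      show "contraction Var (\<lambda>I. \<Sum>l\<in>?L. Const (w' l I) * h' l b) K \<in> P" if b: "b \<in> Bs" for b K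
      proof -
        have "- (\<Sum>l'\<in>?L. w' l' K * v l') / v l = w' l K" for K
          using key[of K] vl unfolding L_split
          by (simp add: field_simps eq_neg_iff_add_eq_0 neg_eq_iff_add_eq_0)
        then have "(\<Sum>l\<in>?L. Const (w' l K) * h' l b) = (\<Sum>l\<in>L. Const (w' l K) * h l b)" for K
          unfolding h'_sum by (intro sum.cong) auto
        also have "(\<Sum>l\<in>L. Const (w' l K) * h l b)
            = contraction (\<lambda>i. Const (c i)) (\<lambda>I. \<Sum>l\<in>L. Const (w l I) * h l b) K" for K
          unfolding w'_def contraction_sum contraction_mult_right
          by (subst contraction_hom[of Const]) simp_all
        finally have "contraction Var (\<lambda>I. \<Sum>l\<in>?L. Const (w' l I) * h' l b) K
            = - contraction (\<lambda>i. Const (c i)) (contraction Var (\<lambda>I. \<Sum>l\<in>L. Const (w l I) * h l b)) K"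
          by (simp add: contraction_anticommute[of Var])
        then show ?thesis
          using ideal_uminus[OF I contraction_ideal[OF I rel[OF b]]] by simp
      qed
      show "l' \<in> ?L" by fact
    qed
    have "w' l J * v l = 0"
      using key[of J] unfolding L_split by (simp add: w'0)
    then show False using vl w'l by simp
  qed
qed auto

section \<open>Positivity of the grading\<close>

text \<open>A ray from an interior point in direction \<open>y\<close> leaves the bounded
  \<open>Q\<close> through some facet, where the corresponding normal takes its minimum; along the
  ray this normal has decreased.\<close>

lemma ex_negative_inner_normal:
  fixes Q :: "(real^'d::finite) set" and u :: "'n::finite \<Rightarrow> int^'d"
  defines "r \<equiv> \<lambda>i. (\<chi> j. real_of_int (u i $ j)) :: real^'d"
  assumes Q: "lattice_polytope_with_normals Q u" and y: "y \<noteq> 0"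
  shows "\<exists>i. r i \<bullet> y < 0"
proof -
  have poly: "polytope Q" "interior Q \<noteq> {}"
    and bij: "bij_betw (facet_at Q u) UNIV {F. F facet_of Q}"
    using Q by (auto simp: lattice_polytope_with_normals_def)
  have u0: "u i \<noteq> 0" for i
    using Q by (auto simp: lattice_polytope_with_normals_def)
  obtain x where x: "x \<in> interior Q" using poly by blast
  have "bounded Q" using poly by (simp add: polytope_imp_bounded)
  from ray_to_frontier[OF this x y] obtain d where d: "0 < d" "x + d *\<^sub>R y \<in> frontier Q" by metis
  let ?z = "x + d *\<^sub>R y"
  have "?z \<in> Q - rel_interior Q"
    using d(2) poly closure_closed[OF polytope_imp_closed[OF poly(1)]]
    by (simp add: frontier_def rel_interior_nonempty_interior)
  then have "?z \<in> \<Union> {F. F facet_of Q}"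
    using rel_boundary_of_polyhedron[OF polytope_imp_polyhedron[OF poly(1)]] by simp
  then have "?z \<in> \<Union> (range (facet_at Q u))"
    using bij_betw_imp_surj_on[OF bij] by simp
  then obtain i where i: "?z \<in> facet_at Q u i" by blast
  then have min: "r i \<bullet> ?z \<le> r i \<bullet> y" if "y \<in> Q" for y
    using that by (simp add: facet_at_def r_def)
  have "r i \<noteq> 0" using u0[of i] by (auto simp: r_def vec_eq_iff)
  \<comment> \<open>Moving from \<open>x\<close> slightly against \<open>r i\<close> stays in
    \<open>Q\<close> and lowers the value, so the value at \<open>x\<close> is strictly above the
    minimum.\<close>
  obtain e where e: "e > 0" "ball x e \<subseteq> Q" using x by (auto simp: mem_interior)
  let ?\<delta> = "e / (2 * norm (r i))"
  have "x - ?\<delta> *\<^sub>R r i \<in> ball x e"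
    using e \<open>r i \<noteq> 0\<close> by (simp add: dist_norm)
  then have "r i \<bullet> ?z \<le> r i \<bullet> (x - ?\<delta> *\<^sub>R r i)" using e min by blast
  also have "\<dots> < r i \<bullet> x"
    using e \<open>r i \<noteq> 0\<close> by (simp add: inner_diff_right)
  finally have "d * (r i \<bullet> y) < 0" by (simp add: inner_add_right)
  then show ?thesis using d(1) by (auto simp: mult_less_0_iff)
qed

text \<open>The origin is interior to the convex hull of the normals, by separation. Hence a small
  negative multiple of their sum \<open>s\<close> is a convex combination of them, and moving it to
  the other side adds \<open>\<epsilon>\<close> to every coefficient.\<close>

lemma positive_relation:
  fixes Q :: "(real^'d::finite) set" and u :: "'n::finite \<Rightarrow> int^'d"
  assumes Q: "lattice_polytope_with_normals Q u"
  obtains c :: "'n \<Rightarrow> real" where "\<And>i. 0 < c i" "\<And>j. (\<Sum>i\<in>UNIV. c i * real_of_int (u i $ j)) = 0"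
proof -
  define r where "r i = ((\<chi> j. real_of_int (u i $ j)) :: real^'d)" for i
  have neg: "\<exists>i. r i \<bullet> y < 0" if "y \<noteq> 0" for y
    using ex_negative_inner_normal[OF Q that] by (simp add: r_def)
  have inj: "inj r"
  proof (rule injI)
    fix i k assume "r i = r k"
    then have "facet_at Q u i = facet_at Q u k" by (simp add: facet_at_def r_def)
    then show "i = k"
      using Q by (auto simp: lattice_polytope_with_normals_def bij_betw_def inj_def)
  qed
  let ?C = "convex hull (range r)"
  have rC: "r i \<in> ?C" for i by (simp add: hull_inc)
  \<comment> \<open>Needed to pass from a half-space containing the interior of the hull to one
    containing all normals, by closure.\<close>
  have "interior ?C \<noteq> {}"
  proof
    assume "interior ?C = {}"
    then obtain a b where ab: "a \<noteq> 0" "?C \<subseteq> {x. a \<bullet> x = b}"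
      using empty_interior_subset_hyperplane[OF convex_convex_hull] by metis
    then have "r i \<bullet> a = b" for i using rC[of i] by (auto simp: inner_commute)
    moreover obtain i where "r i \<bullet> a < 0" using neg[OF ab(1)] by blast
    moreover obtain k where "r k \<bullet> (- a) < 0" using neg[of "- a"] ab(1) by auto
    ultimately show False by (metis inner_minus_right neg_less_0_iff_less not_less_iff_gr_or_eq)
  qed
  have "0 \<in> interior ?C"
  proof (rule ccontr)
    assume "0 \<notin> interior ?C"
    then obtain a where a: "a \<noteq> 0" "\<And>x. x \<in> interior ?C \<Longrightarrow> 0 \<le> a \<bullet> x"
      using separating_hyperplane_set_0[OF convex_interior[OF convex_convex_hull], of "range r"] by blast
    have "closure (interior ?C) \<subseteq> {x. 0 \<le> a \<bullet> x}"
      using a(2) by (intro closure_minimal closed_halfspace_ge) auto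
    then have "?C \<subseteq> {x. 0 \<le> a \<bullet> x}"
      using convex_closure_interior[OF convex_convex_hull \<open>interior ?C \<noteq> {}\<close>] closure_subset[of ?C] by blast
    then have "0 \<le> r i \<bullet> a" for i using rC[of i] by (auto simp: inner_commute)
    then show False using neg[OF a(1)] by (meson not_less)
  qed
  then obtain e where e: "e > 0" "ball 0 e \<subseteq> ?C" by (auto simp: mem_interior)
  define s where "s = (\<Sum>i\<in>UNIV. r i)"
  \<comment> \<open>The \<open>+ 1\<close> keeps the denominator positive when the normals sum to
    zero.\<close>
  define \<epsilon> where "\<epsilon> = e / (2 * (norm s + 1))"
  have pos: "\<epsilon> > 0" using e by (simp add: \<epsilon>_def add_nonneg_pos)
  have "\<epsilon> * norm s \<le> \<epsilon> * (norm s + 1)" using pos by simp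
  also have "\<dots> = e / 2"
    unfolding \<epsilon>_def using norm_ge_zero[of s] by (simp add: field_simps add_nonneg_eq_0_iff)
  also have "\<dots> < e" using e by simp
  finally have "- \<epsilon> *\<^sub>R s \<in> ball 0 e" using pos by simp
  then have "- \<epsilon> *\<^sub>R s \<in> ?C" using e by blast
  then obtain l where l: "\<And>x. x \<in> range r \<Longrightarrow> 0 \<le> l x" "(\<Sum>x\<in>range r. l x *\<^sub>R x) = - \<epsilon> *\<^sub>R s"
    by (auto simp: convex_hull_finite)
  have "(\<Sum>i\<in>UNIV. (\<epsilon> + l (r i)) *\<^sub>R r i) = \<epsilon> *\<^sub>R s + (\<Sum>x\<in>range r. l x *\<^sub>R x)"
    by (simp add: scaleR_add_left sum.distrib s_def scaleR_sum_right sum.reindex[OF inj])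
  then have rel: "(\<Sum>i\<in>UNIV. (\<epsilon> + l (r i)) *\<^sub>R r i) = 0" using l(2) by simp
  show thesis
  proof (rule that[of "\<lambda>i. \<epsilon> + l (r i)"])
    show "0 < \<epsilon> + l (r i)" for i using pos l(1) by (simp add: add_pos_nonneg)
    show "(\<Sum>i\<in>UNIV. (\<epsilon> + l (r i)) * real_of_int (u i $ j)) = 0" for j
      using arg_cong[OF rel, of "\<lambda>v. v $ j"] by (simp add: r_def)
  qed
qed

lemma class_group_map_zero:
  "class_group_map u cl \<Longrightarrow> cl 0 = 0"
  unfolding class_group_map_def by (metis add_cancel_right_left add_0)

lemma mon_deg_add:
  assumes "class_group_map u cl"
  shows "mon_deg cl (s + t) = mon_deg cl s + mon_deg cl t"
proof -
  have "(\<chi> i. int (Poly_Mapping.lookup (s + t) i))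
      = (\<chi> i. int (Poly_Mapping.lookup s i)) + (\<chi> i. int (Poly_Mapping.lookup t i))"
    by (simp add: vec_eq_iff lookup_add)
  then show ?thesis using assms by (simp add: mon_deg_def class_group_map_def)
qed

lemma mon_deg_zero: "class_group_map u cl \<Longrightarrow> mon_deg cl 0 = 0"
  by (simp add: mon_deg_def class_group_map_zero flip: zero_vec_def)

lemma EffS_iff:
  fixes cl :: "(int, 'n::finite) vec \<Rightarrow> 'a"
  shows "a \<in> EffS TYPE('k::field) cl \<longleftrightarrow> (\<exists>t. mon_deg cl t = a)"
proof
  assume "a \<in> EffS TYPE('k) cl"
  moreover have "0 \<in> (S_comp cl a :: ('n, 'k) mpol set)" by (simp add: S_comp_def)
  ultimately obtain p :: "('n, 'k) mpol" where p: "p \<in> S_comp cl a" "p \<noteq> 0"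
    by (auto simp: EffS_def Eff_def)
  then obtain t where "t \<in> Poly_Mapping.keys p" by (metis all_not_in_conv keys_eq_empty)
  then show "\<exists>t. mon_deg cl t = a" using p by (auto simp: S_comp_def)
next
  assume "\<exists>t. mon_deg cl t = a"
  then obtain t where "mon_deg cl t = a" ..
  then have "Poly_Mapping.single t (1 :: 'k) \<in> S_comp cl a"
    by (auto simp: S_comp_def)
  moreover have "Poly_Mapping.single t (1 :: 'k) \<noteq> 0"
    by (metis lookup_single_eq lookup_zero zero_neq_one)
  ultimately show "a \<in> EffS TYPE('k) cl" by (auto simp: EffS_def Eff_def)
qed

lemma ex_minimal_in_Eff:
  fixes cl :: "(int, 'n::finite) vec \<Rightarrow> 'a::ab_group_add" and M :: "'a \<Rightarrow> 'v::zero set"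
  assumes X: "projective_toric Q u cl" and M: "Eff M \<noteq> {}" "Eff M \<subseteq> EffS TYPE('k::field) cl"
  shows "\<exists>a. minimal_in_Eff TYPE('k) cl M a"
proof -
  have cg: "class_group_map u cl" and lp: "lattice_polytope_with_normals Q u"
    using X by (auto simp: projective_toric_def)
  obtain c where c: "\<And>i. 0 < c i" "\<And>j. (\<Sum>i\<in>UNIV. c i * real_of_int (u i $ j)) = 0"
    by (rule positive_relation[OF lp]) blast
  define \<theta> where "\<theta> t = (\<Sum>i\<in>UNIV. c i * real (Poly_Mapping.lookup t i))" for t :: "'n \<Rightarrow>\<^sub>0 nat"
  have \<theta>_add: "\<theta> (s + t) = \<theta> s + \<theta> t" for s t
    by (simp add: \<theta>_def lookup_add distrib_left sum.distrib)
  \<comment> \<open>Exponents of equal class differ by the divisor of a character, which the weights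
    \<open>c\<close> annihilate by the relation among the normals.\<close>
  have \<theta>_cong: "\<theta> s = \<theta> t" if "mon_deg cl s = mon_deg cl t" for s t
  proof -
    let ?s = "\<chi> i. int (Poly_Mapping.lookup s i)" and ?t = "\<chi> i. int (Poly_Mapping.lookup t i)"
    have "cl (D + D') = cl D + cl D'" for D D'
      using cg unfolding class_group_map_def by blast
    from this[of "?s - ?t" ?t] have "cl ?s = cl (?s - ?t) + cl ?t"
      by (simp only: diff_add_cancel)
    then have "cl (?s - ?t) = 0" using that by (simp add: mon_deg_def)
    then obtain m where m: "?s - ?t = (\<chi> i. \<Sum>j\<in>UNIV. m $ j * u i $ j)"
      using cg unfolding class_group_map_def by blast
    have "real (Poly_Mapping.lookup s i) - real (Poly_Mapping.lookup t i)
        = (\<Sum>j\<in>UNIV. real_of_int (m $ j) * real_of_int (u i $ j))" for i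
    proof -
      have "int (Poly_Mapping.lookup s i) - int (Poly_Mapping.lookup t i) = (\<Sum>j\<in>UNIV. m $ j * u i $ j)"
        using arg_cong[OF m, of "\<lambda>v. v $ i"] by simp
      from arg_cong[OF this, of real_of_int] show ?thesis by simp
    qed
    then have "\<theta> s - \<theta> t = (\<Sum>i\<in>UNIV. c i * (\<Sum>j\<in>UNIV. real_of_int (m $ j) * real_of_int (u i $ j)))"
      by (simp add: \<theta>_def flip: sum_subtractf right_diff_distrib)
    also have "\<dots> = (\<Sum>j\<in>UNIV. real_of_int (m $ j) * (\<Sum>i\<in>UNIV. c i * real_of_int (u i $ j)))"
      unfolding sum_distrib_left by (subst sum.swap) (simp add: mult.left_commute)
    finally show ?thesis by (simp add: c(2))
  qed
  have \<theta>_bound: "c i * real (Poly_Mapping.lookup t i) \<le> \<theta> t" for t i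
    unfolding \<theta>_def by (rule member_le_sum) (auto intro: mult_nonneg_nonneg less_imp_le[OF c(1)])
  have \<theta>_nonneg: "0 \<le> \<theta> t" for t
    unfolding \<theta>_def by (intro sum_nonneg mult_nonneg_nonneg less_imp_le[OF c(1)]) simp
  have \<theta>_zero: "t = 0" if "\<theta> t \<le> 0" for t
  proof (rule poly_mapping_eqI)
    fix i
    have "c i * real (Poly_Mapping.lookup t i) \<le> 0" using \<theta>_bound[of i t] that by linarith
    then show "Poly_Mapping.lookup t i = Poly_Mapping.lookup 0 i"
      using c(1)[of i] by (auto simp: mult_le_0_iff)
  qed
  define mon where "mon a = (SOME t. mon_deg cl t = a)" for a
  have mon: "mon_deg cl (mon a) = a" if "a \<in> EffS TYPE('k) cl" for a
    unfolding mon_def using that EffS_iff by (metis (mono_tags, lifting) someI_ex)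
  have mon_split: "\<theta> (mon a) = \<theta> (mon a') + \<theta> (mon (a - a'))"
    if "a \<in> EffS TYPE('k) cl" "a' \<in> EffS TYPE('k) cl" "a - a' \<in> EffS TYPE('k) cl" for a a'
    using that by (subst \<theta>_add[symmetric], intro \<theta>_cong) (simp add: mon_deg_add[OF cg] mon)
  obtain a0 where a0: "a0 \<in> Eff M" using M by blast
  define T where "T = {a \<in> Eff M. a0 - a \<in> EffS TYPE('k) cl}"
  have "a0 \<in> T" using a0 mon_deg_zero[OF cg] by (auto simp: T_def EffS_iff)
  obtain N :: nat where N: "\<And>i. \<theta> (mon a0) / c i \<le> real N"
  proof -
    obtain N :: nat where "Max (range (\<lambda>i. \<theta> (mon a0) / c i)) \<le> real N"
      using real_arch_simple by blast
    then show thesis by (intro that[of N]) (auto intro: order_trans[OF Max_ge])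
  qed
  \<comment> \<open>As every \<open>c i\<close> is positive, a bound on \<open>\<theta>\<close>
    bounds all exponents, which leaves finitely many monomials.\<close>
  have "T \<subseteq> mon_deg cl ` {t. \<forall>i. Poly_Mapping.lookup t i \<le> N}"
  proof
    fix a assume a: "a \<in> T"
    then have aE: "a \<in> EffS TYPE('k) cl" using M by (auto simp: T_def)
    have "\<theta> (mon a) \<le> \<theta> (mon a0)"
      using mon_split[of a0 a] a aE a0 M \<theta>_nonneg[of "mon (a0 - a)"] by (auto simp: T_def)
    then have "Poly_Mapping.lookup (mon a) i \<le> N" for i
      using \<theta>_bound[of i "mon a"] N[of i] c(1)[of i]
      by (simp add: divide_le_eq) (metis (no_types, opaque_lifting) mult.commute mult_le_cancel_left_pos of_nat_le_iff order_trans)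
    then show "a \<in> mon_deg cl ` {t. \<forall>i. Poly_Mapping.lookup t i \<le> N}"
      using mon[OF aE] by (intro image_eqI[of _ _ "mon a"]) auto
  qed
  moreover have "finite {t :: 'n \<Rightarrow>\<^sub>0 nat. \<forall>i. Poly_Mapping.lookup t i \<le> N}"
  proof (rule finite_imageD)
    have "Poly_Mapping.lookup ` {t :: 'n \<Rightarrow>\<^sub>0 nat. \<forall>i. Poly_Mapping.lookup t i \<le> N} \<subseteq> PiE UNIV (\<lambda>_. {..N})"
      by auto
    then show "finite (Poly_Mapping.lookup ` {t :: 'n \<Rightarrow>\<^sub>0 nat. \<forall>i. Poly_Mapping.lookup t i \<le> N})"
      by (rule finite_subset) (simp add: finite_PiE)
  qed (auto intro: inj_onI poly_mapping_eqI)
  ultimately have "finite T" by (rule finite_surj[rotated])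
  then obtain a where a: "a \<in> T" and least: "\<And>a'. a' \<in> T \<Longrightarrow> \<theta> (mon a) \<le> \<theta> (mon a')"
    using \<open>a0 \<in> T\<close> ex_is_arg_min_if_finite[of T "\<lambda>a. \<theta> (mon a)"]
    by (auto simp: is_arg_min_def not_less)
  \<comment> \<open>\<open>\<theta>\<close> is additive on effective differences, so leastness
    forces the difference to have \<open>\<theta> \<le> 0\<close>, and only the monomial
    \<open>1\<close> does.\<close>
  have "a' = a" if a': "a' \<in> Eff M" "a - a' \<in> EffS TYPE('k) cl" for a'
  proof -
    have aE: "a \<in> EffS TYPE('k) cl" "a' \<in> EffS TYPE('k) cl" "a0 - a \<in> EffS TYPE('k) cl"
      using a a' M by (auto simp: T_def)
    have "mon_deg cl (mon (a0 - a) + mon (a - a')) = a0 - a'"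
      using aE a' by (simp add: mon_deg_add[OF cg] mon)
    then have "a' \<in> T" using a'(1) by (auto simp: T_def EffS_iff)
    then have "\<theta> (mon (a - a')) \<le> 0"
      using least mon_split[OF aE(1,2) a'(2)] by fastforce
    then have "a - a' = 0"
      using \<theta>_zero mon[OF a'(2)] mon_deg_zero[OF cg] by metis
    then show ?thesis by simp
  qed
  then show ?thesis using a by (auto simp: minimal_in_Eff_def T_def)
qed

section \<open>Sections of vector bundles\<close>

text \<open>By Zorn's lemma some ideal is maximal among those containing \<open>J\<close> and
  avoiding the powers of \<open>g\<close>; such an ideal is prime.\<close>

lemma ex_prime_ideal_avoiding:
  fixes J :: "'r::comm_ring_1 set"
  assumes J: "is_ideal J" and g: "\<And>n. g ^ n \<notin> J"
  shows "\<exists>q. is_prime_ideal q \<and> J \<subseteq> q \<and> g \<notin> q"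
proof -
  let ?A = "{I. is_ideal I \<and> J \<subseteq> I \<and> (\<forall>n. g ^ n \<notin> I)}"
  have union: "\<Union>C \<in> ?A" if "C \<noteq> {}" "subset.chain ?A C" for C
  proof -
    have C: "C \<subseteq> ?A" and chain: "\<And>S T. S \<in> C \<Longrightarrow> T \<in> C \<Longrightarrow> S \<subseteq> T \<or> T \<subseteq> S"
      using that(2) by (auto simp: subset.chain_def)
    have "x + y \<in> \<Union>C" if xy: "x \<in> \<Union>C" "y \<in> \<Union>C" for x y
    proof -
      obtain S T where ST: "S \<in> C" "T \<in> C" "x \<in> S" "y \<in> T" using xy by auto
      then have "x \<in> S \<union> T" "y \<in> S \<union> T" "S \<union> T \<in> C"
        using chain[OF ST(1,2)] by (auto simp: sup.absorb1 sup.absorb2)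
      then show ?thesis using C ideal_add by blast
    qed
    moreover have "0 \<in> \<Union>C"
      using C \<open>C \<noteq> {}\<close> ideal_zero by blast
    moreover have "c * x \<in> \<Union>C" if "x \<in> \<Union>C" for c x
      using C that ideal_mult_left by blast
    ultimately have "is_ideal (\<Union>C)"
      by (simp add: is_ideal_iff)
    then show ?thesis using C \<open>C \<noteq> {}\<close> by blast
  qed
  have "?A \<noteq> {}" using J g by auto
  from subset_Zorn_nonempty[OF this union]
  obtain q where q: "q \<in> ?A" and max: "\<forall>I\<in>?A. q \<subseteq> I \<longrightarrow> I = q"
    by (rule bexE)
  have I: "is_ideal q" and Jq: "J \<subseteq> q" and gq: "\<And>n. g ^ n \<notin> q" using q by auto
  have power: "\<exists>n m c. m \<in> q \<and> g ^ n = m + c * x" if x: "x \<notin> q" for x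
  proof (rule ccontr)
    assume contra: "\<not> ?thesis"
    let ?I = "{m + c * x | m c. m \<in> q}"
    have memI: "m + c * x \<in> ?I" if "m \<in> q" for m c using that by blast
    have "is_ideal ?I"
      unfolding is_ideal_iff
    proof (intro conjI ballI allI)
      show "0 \<in> ?I" using memI[OF ideal_zero[OF I], of 0] by simp
      fix a b assume a: "a \<in> ?I"
      then obtain m c where mc: "a = m + c * x" "m \<in> q" by auto
      show "d * a \<in> ?I" for d
      proof -
        have "d * a = d * m + (d * c) * x" by (simp add: mc(1) algebra_simps)
        then show ?thesis using memI[OF ideal_mult_left[OF I mc(2), of d], of "d * c"] by (simp only:)
      qed
      assume "b \<in> ?I"
      then obtain m' c' where m'c': "b = m' + c' * x" "m' \<in> q" by auto
      have "a + b = (m + m') + (c + c') * x" by (simp add: mc(1) m'c'(1) algebra_simps)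
      then show "a + b \<in> ?I" using memI[OF ideal_add[OF I mc(2) m'c'(2)], of "c + c'"] by (simp only:)
    qed
    moreover have "q \<subseteq> ?I" using memI[where c = 0] by auto
    moreover have "g ^ n \<notin> ?I" for n using contra by blast
    ultimately have "?I = q" using max[rule_format, of ?I] Jq by blast
    moreover have "x \<in> ?I" using memI[OF ideal_zero[OF I], of 1] by simp
    ultimately show False using x by blast
  qed
  have "x \<in> q \<or> y \<in> q" if xy: "x * y \<in> q" for x y
  proof (rule ccontr)
    assume "\<not> ?thesis"
    then obtain n m c n' m' c' where mc: "m \<in> q" "g ^ n = m + c * x" "m' \<in> q" "g ^ n' = m' + c' * y"
      using power[of x] power[of y] by blast
    have "g ^ (n + n') = (m + c * x) * m' + (c' * y) * m + (c * c') * (x * y)"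
      by (simp add: power_add mc algebra_simps)
    also have "\<dots> \<in> q" by (intro ideal_add[OF I] ideal_mult_left[OF I mc(3)] ideal_mult_left[OF I mc(1)]
        ideal_mult_left[OF I xy])
    finally show False using gq by blast
  qed
  moreover have "q \<noteq> UNIV" using gq by blast
  ultimately have "is_prime_ideal q" using I by (auto simp: is_prime_ideal_def)
  then show ?thesis using Jq gq[of 1] by auto
qed

section \<open>Torsion-freeness of the sections of a bundle\<close>

context
  fixes B P :: "('n::finite, 'k::field) mpol set"
    and F :: "(('n, 'k) mpol, 'a, 'm::ab_group_add) esheaf"
  assumes Q: "qcoh_sheaf B P F"
begin

lemma sheaf_module: "Modules.module (act F)"
  using Q by (simp add: qcoh_sheaf_def)

interpretation A: Modules.module "act F"
  by (rule sheaf_module)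

lemma sec_subspace: "f \<in> B \<Longrightarrow> A.subspace (sec F f)"
  using Q by (simp add: qcoh_sheaf_def)

lemma sec_scale: "f \<in> B \<Longrightarrow> x \<in> sec F f \<Longrightarrow> act F p x \<in> sec F f"
  using A.subspace_scale[OF sec_subspace] .

lemma sec_power_inj:
  assumes f: "f \<in> B" and x: "x \<in> sec F f" and "act F (f ^ n) x = 0"
  shows "x = 0"
  using assms(3)
proof (induction n)
  case (Suc n)
  have "inj_on (act F f) (sec F f)"
    using Q f by (auto simp: qcoh_sheaf_def bij_betw_def)
  moreover have "act F f (act F (f ^ n) x) = act F f 0" using Suc.prems by simp
  ultimately have "act F (f ^ n) x = 0"
    using sec_scale[OF f x] A.subspace_0[OF sec_subspace[OF f]] by (rule inj_onD)
  then show ?case by (rule Suc.IH)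
qed simp

lemma prime_act_zero: "f \<in> B \<Longrightarrow> p \<in> P \<Longrightarrow> x \<in> sec F f \<Longrightarrow> act F p x = 0"
  using Q by (simp add: qcoh_sheaf_def)

lemma res_simps:
  assumes "f \<in> B" "g \<in> B" "f dvd g"
  shows "x \<in> sec F f \<Longrightarrow> res F f g x \<in> sec F g"
    and "x \<in> sec F f \<Longrightarrow> y \<in> sec F f \<Longrightarrow> res F f g (x + y) = res F f g x + res F f g y"
    and "x \<in> sec F f \<Longrightarrow> res F f g (act F p x) = act F p (res F f g x)"
    and "y \<in> sec F g \<Longrightarrow> \<exists>n. \<exists>x\<in>sec F f. act F (g ^ n) y = res F f g x"
    and "x \<in> sec F f \<Longrightarrow> res F f g x = 0 \<Longrightarrow> \<exists>n. act F (g ^ n) x = 0"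
  using Q assms by (simp_all add: qcoh_sheaf_def)

lemma res_zero: "f \<in> B \<Longrightarrow> g \<in> B \<Longrightarrow> f dvd g \<Longrightarrow> res F f g 0 = 0"
  using res_simps(3)[of f g 0 0] A.subspace_0[OF sec_subspace] by simp

text \<open>Multiplying the coordinates of \<open>y\<close> by \<open>p\<close> puts them into
  \<open>P\<close> up to powers of \<open>h\<close>, and \<open>P\<close> is prime.\<close>

lemma free_basis_torsion_free:
  assumes P: "is_prime_ideal P" and h: "h \<in> B" "h \<notin> P" and Bs: "free_basis P F h Bs"
    and y: "y \<in> sec F h" and p: "p \<notin> P" "act F p y = 0"
  shows "y = 0"
proof -
  obtain n c where c: "act F (h ^ n) y = (\<Sum>x\<in>Bs. act F (c x) x)"
    using Bs y unfolding free_basis_def by blast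
  have "(\<Sum>x\<in>Bs. act F (p * c x) x) = act F p (act F (h ^ n) y)"
    by (simp add: c A.scale_sum_right)
  also have "\<dots> = act F (h ^ n) (act F p y)" by (simp add: mult.commute)
  finally have "(\<Sum>x\<in>Bs. act F (p * c x) x) = 0" by (simp add: p)
  then have "\<exists>n. h ^ n * (p * c x) \<in> P" if "x \<in> Bs" for x
    using Bs that unfolding free_basis_def by meson
  then have "c x \<in> P" if "x \<in> Bs" for x
    using that p h prime_power[OF P, of h] by (auto simp: prime_mult_iff[OF P])
  then have "act F (c x) x = 0" if "x \<in> Bs" for x
    using that prime_act_zero[OF h(1)] Bs by (auto simp: free_basis_def)
  then have "act F (h ^ n) y = 0" by (simp add: c)
  then show ?thesis by (rule sec_power_inj[OF h(1) y])
qed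

text \<open>If \<open>s g\<close> were nonzero, its annihilator would lie in a prime
  \<open>q\<close> not containing \<open>g\<close>, a point of \<open>D(g)\<close> in its support.
  Near \<open>q\<close> the bundle is free over a domain, where a power of \<open>f * g\<close> can
  only kill zero; so some power of \<open>g * h\<close> annihilates \<open>s g\<close>, although it
  is outside \<open>q\<close>.\<close>

lemma section_torsion_free:
  assumes P: "is_prime_ideal P" and B: "is_ideal B" and lf: "locally_free B P F"
    and s: "\<And>f. f \<in> B \<Longrightarrow> s f \<in> sec F f"
      "\<And>f g. f \<in> B \<Longrightarrow> g \<in> B \<Longrightarrow> f dvd g \<Longrightarrow> res F f g (s f) = s g"
    and f: "f \<in> B" "f \<notin> P" "s f = 0" and g: "g \<in> B"
  shows "s g = 0"
proof (rule ccontr)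
  assume nz: "s g \<noteq> 0"
  define J where "J = {p. act F p (s g) = 0}"
  have J: "is_ideal J"
    unfolding is_ideal_iff J_def by (auto simp: A.scale_left_distrib simp flip: A.scale_scale)
  have "g ^ n \<notin> J" for n
    using sec_power_inj[OF g s(1)[OF g]] nz by (auto simp: J_def)
  then obtain q where q: "is_prime_ideal q" "J \<subseteq> q" "g \<notin> q"
    using ex_prime_ideal_avoiding[OF J] by blast
  have "P \<subseteq> q" using prime_act_zero[OF g _ s(1)[OF g]] q(2) by (auto simp: J_def)
  then obtain h Bs where h: "h \<in> B" "h \<notin> q" and Bs: "free_basis P F h Bs"
    using lf q g unfolding locally_free_def by blast
  have notP: "g \<notin> P" "h \<notin> P" using q h \<open>P \<subseteq> q\<close> by auto
  have fg: "f * g \<in> B" and gh: "g * h \<in> B"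
    using ideal_mult_left[OF B] g h(1) by auto
  have "res F g (f * g) (s g) = 0"
    using s(2)[OF f(1) fg] s(2)[OF g fg] res_zero[OF f(1) fg] f(3) by simp
  then obtain n where n: "act F ((f * g) ^ n) (s g) = 0"
    using res_simps(5)[OF g fg _ s(1)[OF g]] by auto
  define y where "y = res F g (g * h) (s g)"
  have y: "y \<in> sec F (g * h)" unfolding y_def by (rule res_simps(1)[OF g gh _ s(1)[OF g]]) simp
  have yn: "act F ((f * g) ^ n) y = 0"
    unfolding y_def using res_simps(3)[OF g gh _ s(1)[OF g], of "(f * g) ^ n"] n res_zero[OF g gh] by simp
  \<comment> \<open>The basis lives on \<open>D(h)\<close>, while \<open>y\<close> lives on
    \<open>D(g * h)\<close>; a power of \<open>g * h\<close> brings \<open>y\<close> back to a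
    section on \<open>D(h)\<close>.\<close>
  obtain k x where x: "x \<in> sec F h" "act F ((g * h) ^ k) y = res F h (g * h) x"
    using res_simps(4)[OF h(1) gh _ y] by auto
  have "res F h (g * h) (act F ((f * g) ^ n) x) = act F ((f * g) ^ n) (act F ((g * h) ^ k) y)"
    using res_simps(3)[OF h(1) gh _ x(1)] x(2) by simp
  also have "\<dots> = act F ((g * h) ^ k) (act F ((f * g) ^ n) y)" by (simp add: mult.commute)
  finally have "res F h (g * h) (act F ((f * g) ^ n) x) = 0" by (simp add: yn)
  then obtain k' where "act F ((g * h) ^ k') (act F ((f * g) ^ n) x) = 0"
    using res_simps(5)[OF h(1) gh _ sec_scale[OF h(1) x(1)]] by auto
  then have "act F ((g * h) ^ k' * (f * g) ^ n) x = 0" by simp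
  moreover have "(g * h) ^ k' * (f * g) ^ n \<notin> P"
    using notP f(2) prime_power[OF P] by (metis prime_mult_iff[OF P])
  ultimately have "x = 0"
    using free_basis_torsion_free[OF P h(1) notP(2) Bs x(1)] by blast
  then have "act F ((g * h) ^ k) y = 0" using x(2) res_zero[OF h(1) gh] by simp
  then have "y = 0" by (rule sec_power_inj[OF gh y])
  then obtain k'' where "act F ((g * h) ^ k'') (s g) = 0"
    using res_simps(5)[OF g gh _ s(1)[OF g]] by (auto simp: y_def)
  then have "(g * h) ^ k'' \<in> q" using q(2) by (auto simp: J_def)
  then show False using prime_power[OF q(1), of "g * h" k''] q(3) h(2) by (auto simp: prime_mult_iff[OF q(1)])
qed

end

section \<open>Base change to the algebraic closure\<close>


lemma ex_alg_closure_functional: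
  fixes x :: "'k::field alg_closure"
  assumes "x \<noteq> 0"
  obtains \<psi> :: "'k alg_closure \<Rightarrow> 'k" where "\<And>x y. \<psi> (x + y) = \<psi> x + \<psi> y" "\<psi> 0 = 0"
    "\<And>x a. \<psi> (x * to_ac a) = \<psi> x * a" "\<psi> x \<noteq> 0"
proof -
  interpret V: vector_space "\<lambda>(c::'k) (x::'k alg_closure). to_ac c * x"
    by unfold_locales (simp_all add: algebra_simps)
  interpret W: vector_space "(*) :: 'k \<Rightarrow> 'k \<Rightarrow> 'k"
    by unfold_locales (simp_all add: algebra_simps)
  interpret VW: vector_space_pair "\<lambda>(c::'k) (x::'k alg_closure). to_ac c * x" "(*) :: 'k \<Rightarrow> 'k \<Rightarrow> 'k" ..
  have "V.independent {x}" using assms by (simp add: V.dependent_single)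
  then obtain \<psi> where \<psi>: "Vector_Spaces.linear (\<lambda>c x. to_ac c * x) (*) \<psi>" "\<psi> x = 1"
    using VW.linear_independent_extend[of "{x}" "\<lambda>_. 1"] by auto
  interpret \<psi>: Vector_Spaces.linear "\<lambda>(c::'k) (x::'k alg_closure). to_ac c * x" "(*)" \<psi>
    by (rule \<psi>(1))
  show thesis
  proof (rule that[of \<psi>])
    show "\<psi> (x * to_ac a) = \<psi> x * a" for x a
      using \<psi>.scale[of a x] by (simp add: mult.commute)
  qed (simp_all add: \<psi>.add \<psi>.zero \<psi>(2))
qed

text \<open>The extended ideal consists of combinations of elements of \<open>P\<close> with
  polynomials over the closure as coefficients, and \<open>\<psi>\<close> acts on these coefficients
  alone.\<close>

lemma map_functional_extended_ideal:
  fixes P :: "('n::finite, 'k::field) mpol set"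
  assumes P: "is_ideal P" and p: "p \<in> ideal_of (Poly_Mapping.map to_ac ` P)"
    and \<psi>: "\<And>x y. \<psi> (x + y) = \<psi> x + \<psi> y" "\<psi> 0 = 0" "\<And>x a. \<psi> (x * to_ac a) = \<psi> x * a"
  shows "Poly_Mapping.map \<psi> p \<in> P"
  using p
proof (induction p rule: ideal_of_induct)
  case (step c x y)
  then show ?case
    by (auto simp: poly_mapping_map_add \<psi> poly_mapping_map_semilinear_mult[of to_ac \<psi>]
        intro!: ideal_add[OF P] ideal_mult_left[OF P])
qed (simp add: poly_mapping_map_zero \<psi> ideal_zero[OF P])

text \<open>A functional that does not kill a nonzero \<open>\<mu> l\<close> turns a relation over
  the closure into a nontrivial one over the base field.\<close>

lemma independent_mod_extended_ideal:
  fixes P :: "('n::finite, 'k::field) mpol set" and h :: "'l \<Rightarrow> 'b \<Rightarrow> ('n, 'k) mpol"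
  assumes P: "is_ideal P"
    and ind: "\<And>\<mu>. (\<And>b. b \<in> Bs \<Longrightarrow> (\<Sum>l\<in>L. Const (\<mu> l) * h l b) \<in> P) \<Longrightarrow> \<forall>l\<in>L. \<mu> l = 0"
    and \<mu>: "\<And>b. b \<in> Bs \<Longrightarrow>
      (\<Sum>l\<in>L. Const (\<mu> l) * Poly_Mapping.map to_ac (h l b)) \<in> ideal_of (Poly_Mapping.map to_ac ` P)"
  shows "\<forall>l\<in>L. \<mu> l = 0"
proof (rule ccontr)
  assume "\<not> ?thesis"
  then obtain l where l: "l \<in> L" "\<mu> l \<noteq> 0" by blast
  obtain \<psi> :: "'k alg_closure \<Rightarrow> 'k" where \<psi>: "\<And>x y. \<psi> (x + y) = \<psi> x + \<psi> y" "\<psi> 0 = 0"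
    "\<And>x a. \<psi> (x * to_ac a) = \<psi> x * a" "\<psi> (\<mu> l) \<noteq> 0"
    by (rule ex_alg_closure_functional[OF l(2)]) blast
  have "(\<Sum>l\<in>L. Const (\<psi> (\<mu> l)) * h l b) \<in> P" if "b \<in> Bs" for b
    using map_functional_extended_ideal[OF P \<mu>[OF that] \<psi>(1-3)]
    by (simp add: poly_mapping_map_sum \<psi> poly_mapping_map_semilinear_mult[of to_ac \<psi>] map_Const)
  then have "\<forall>l\<in>L. \<psi> (\<mu> l) = 0" by (rule ind)
  then show False using l \<psi>(4) by blast
qed

section \<open>Absence of linear forms in a nondegenerate ideal\<close>

lemma lookup_nondegenerate:
  assumes "p \<in> ideal_of {Var i * Var j | i j. True}"
  shows "Poly_Mapping.lookup p (Poly_Mapping.single k 1) = 0"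
  using assms
proof (induction p rule: ideal_of_induct)
  case (step c x y)
  then obtain i j where x: "x = Var i * Var j" by blast
  have "Poly_Mapping.lookup (c * x) (Poly_Mapping.single k 1) = 0"
  proof (induction c rule: poly_mapping_add_single_induct)
    case (add_single c t a)
    have "t + (Poly_Mapping.single i 1 + Poly_Mapping.single j 1) \<noteq> Poly_Mapping.single k (1 :: nat)"
    proof
      assume eq: "t + (Poly_Mapping.single i 1 + Poly_Mapping.single j 1) = Poly_Mapping.single k (1 :: nat)"
      have "Poly_Mapping.lookup t l + ((1 when i = l) + (1 when j = l)) = (1 when k = l)" for l
        using arg_cong[OF eq, of "\<lambda>s. Poly_Mapping.lookup s l"] by (simp add: lookup_add lookup_single)
      from this[of i] this[of j] show False
        by (auto simp: when_def split: if_splits)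
    qed
    then have "Poly_Mapping.lookup (Poly_Mapping.single t a * x) (Poly_Mapping.single k 1) = 0"
      by (simp add: x Var_def mult_single lookup_single)
    with add_single show ?case by (simp add: distrib_right lookup_add)
  qed simp
  with step show ?case by (simp add: lookup_add)
qed simp

lemma nondegenerate_linear_form:
  fixes P :: "('n::finite, 'k::field) mpol set"
  assumes "nondegenerate P" "(\<Sum>i\<in>UNIV. Const (\<nu> i) * Var i) \<in> P"
  shows "\<nu> k = 0"
proof -
  have eq: "Const (\<nu> i) * Var i = Poly_Mapping.single (Poly_Mapping.single i 1) (\<nu> i)" for i
    by (simp add: Const_def Var_def mult_single)
  have inj: "Poly_Mapping.single i (Suc 0) = Poly_Mapping.single k (Suc 0) \<longleftrightarrow> i = k" for i :: 'n
    by (metis keys_single singleton_inject nat.distinct(1))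
  have "(\<Sum>i\<in>UNIV. Poly_Mapping.lookup (Const (\<nu> i) * Var i) (Poly_Mapping.single k 1)) = 0"
    using lookup_nondegenerate[of "\<Sum>i\<in>UNIV. Const (\<nu> i) * Var i" k] assms
    by (auto simp: nondegenerate_def lookup_sum)
  then show ?thesis
    by (simp only: eq) (simp add: lookup_single inj when_def)
qed

section \<open>The strongly linear strand\<close>

definition ext_basis :: "'n set \<Rightarrow> ('n, 'k::field) ext" where
  "ext_basis I = (\<lambda>K. if K = I then 1 else 0)"

lemma sum_fun_app: "(\<Sum>i\<in>T. f i) x = (\<Sum>i\<in>T. f i x :: 'b::comm_monoid_add)"
  by (induction T rule: infinite_finite_induct) simp_all

lemma ext_basis_expansion:
  fixes x :: "('n::finite, 'k::field) ext"
  shows "x = (\<Sum>I\<in>UNIV. (\<lambda>K. x I * ext_basis I K))"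
  by (rule ext) (simp add: ext_basis_def sum_fun_app if_distrib cong: if_cong)

lemma ext_mult_gen_basis:
  fixes i :: "'n::{finite,linorder}"
  shows "ext_mult (ext_gen i) (ext_basis J) =
    (if i \<in> J then 0 else (\<lambda>K. shuffle_sign i J * ext_basis (insert i J) K) :: ('n, 'k::field) ext)"
proof (rule ext)
  fix K
  have "(\<Sum>I\<in>Pow K. (- 1) ^ card {(a, b). a \<in> I \<and> b \<in> K - I \<and> b < a} * ext_gen i I * ext_basis J (K - I))
    = (\<Sum>I\<in>Pow K. if I = {i} then (- 1) ^ card {(a, b). a \<in> I \<and> b \<in> K - I \<and> b < a} * ext_basis J (K - I) else 0 :: 'k)"
    by (intro sum.cong) (auto simp: ext_gen_def)
  also have "\<dots> = (if i \<in> K then (- 1) ^ card {(a, b). a \<in> {i} \<and> b \<in> K - {i} \<and> b < a} * ext_basis J (K - {i}) else 0)"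
    by simp
  also have "{(a, b). a \<in> {i} \<and> b \<in> K - {i} \<and> b < a} = Pair i ` {b \<in> K - {i}. b < i}"
    by auto
  also have "card \<dots> = card {b \<in> K - {i}. b < i}"
    by (rule card_image) (simp add: inj_on_def)
  finally have mult: "ext_mult (ext_gen i) (ext_basis J) K
      = (if i \<in> K then (- 1) ^ card {b \<in> K - {i}. b < i} * ext_basis J (K - {i}) else 0 :: 'k)"
    by (simp only: ext_mult_def)
  show "ext_mult (ext_gen i) (ext_basis J) K =
    (if i \<in> J then 0 else (\<lambda>K. shuffle_sign i J * ext_basis (insert i J) K) :: ('n, 'k) ext) K"
  proof (cases "i \<in> K \<and> K - {i} = J")
    case True
    then have "i \<notin> J" "K = insert i J" "{b \<in> K - {i}. b < i} = {b \<in> J. b < i}" by auto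
    then show ?thesis using True unfolding mult by (simp add: ext_basis_def shuffle_sign_def)
  next
    case False
    then have "i \<notin> J \<Longrightarrow> K \<noteq> insert i J" by auto
    then show ?thesis using False unfolding mult by (auto simp: ext_basis_def)
  qed
qed

lemma left_gen_zero: "left_gen i 0 e = 0"
  by (simp add: left_gen_def right_mult_def aux_sign_def)

context
  fixes smul :: "('n::{finite,linorder}, 'k::field) mpol \<Rightarrow> 'v \<Rightarrow> 'v::ab_group_add"
  assumes smul: "Modules.module smul"
begin

interpretation S: Modules.module smul by (rule smul)

lemma vector_space_kscale: "vector_space (kscale smul)"
  by unfold_locales (simp_all add: kscale_def S.scale_right_distrib S.scale_left_distrib)

context
  fixes \<phi> :: "('n, 'k, 'v) omega" and V
  assumes \<phi>: "\<phi> \<in> tensor_omega (kscale smul) V"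
begin

lemma omega_add: "\<phi> (\<lambda>I. x I + y I) = \<phi> x + \<phi> y"
  and omega_scale: "\<phi> (\<lambda>I. c * x I) = smul (Const c) (\<phi> x)"
proof -
  interpret \<phi>: Vector_Spaces.linear "\<lambda>c x I. c * x I" "kscale smul" \<phi>
    using \<phi> by (simp add: tensor_omega_def)
  show "\<phi> (\<lambda>I. x I + y I) = \<phi> x + \<phi> y"
    using \<phi>.add[of x y] by (simp add: plus_fun_def)
  show "\<phi> (\<lambda>I. c * x I) = smul (Const c) (\<phi> x)"
    using \<phi>.scale[of c x] by (simp add: kscale_def)
qed

lemma omega_zero: "\<phi> 0 = 0" "\<phi> (\<lambda>_. 0) = 0"
  using omega_scale[of 0 "\<lambda>_. 0"] by (simp_all add: zero_fun_def)

lemma omega_eq_zero: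
  assumes "\<And>I. \<phi> (ext_basis I) = 0"
  shows "\<phi> = 0"
proof
  fix x
  have "\<phi> (\<Sum>I\<in>T. (\<lambda>K. x I * ext_basis I K)) = 0" for T
  proof (induction T rule: infinite_finite_induct)
    case (insert I T)
    then show ?case
      using omega_add[of "\<lambda>K. x I * ext_basis I K" "\<Sum>I\<in>T. (\<lambda>K. x I * ext_basis I K)"]
      by (simp add: plus_fun_def omega_scale assms)
  qed (simp_all add: omega_zero)
  from this[of UNIV] show "\<phi> x = 0 x"
    by (subst ext_basis_expansion) simp
qed

text \<open>The sign \<open>(- 1) ^ Suc (card J)\<close> comes from turning right into left
  multiplication. It does not depend on \<open>i\<close>, so it drops out of the kernel
  condition.\<close>

lemma left_gen_basis:
  "left_gen i \<phi> (ext_basis J) =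
     (if i \<in> J then 0 else smul (Const ((- 1) ^ Suc (card J) * shuffle_sign i J)) (\<phi> (ext_basis (insert i J))))"
proof (cases "i \<in> J")
  case False
  have "left_gen i \<phi> (ext_basis J)
      = \<phi> (\<lambda>I. (- 1) ^ card I * (shuffle_sign i J * ext_basis (insert i J) I))"
    using False by (simp add: left_gen_def right_mult_def aux_sign_def ext_mult_gen_basis)
  also have "(\<lambda>I. (- 1) ^ card I * (shuffle_sign i J * ext_basis (insert i J) I))
      = (\<lambda>I. ((- 1) ^ Suc (card J) * shuffle_sign i J) * ext_basis (insert i J) I :: 'k)"
    using False by (auto simp: ext_basis_def)
  finally show ?thesis using False by (simp only: omega_scale if_False)
qed (simp add: left_gen_def right_mult_def aux_sign_def ext_mult_gen_basis omega_zero)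

end

lemma K_mod_relation:
  fixes cl :: "(int, 'n) vec \<Rightarrow> 'a::ab_group_add"
  assumes \<phi>: "\<phi> \<in> K_mod cl smul M a"
  shows "(\<Sum>i\<in>-J. smul (shuffle_sign i J * Var i) (\<phi> (ext_basis (insert i J)))) = 0"
proof -
  have t: "\<phi> \<in> tensor_omega (kscale smul) (M a)" using \<phi> by (simp add: K_mod_def)
  let ?g = "\<lambda>i. smul (Var i) (left_gen i \<phi> (ext_basis J))"
  \<comment> \<open>Summing over the set of degrees \<open>a + var_deg cl i\<close> counts every
    variable once, also when several variables share a degree and hence an entry of
    \<open>R_diff\<close>.\<close>
  have "0 = (\<Sum>b\<in>(\<lambda>i. a + var_deg cl i) ` UNIV. R_diff cl smul (\<lambda>b. if b = a then \<phi> else 0) b (ext_basis J))"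
    using \<phi> by (simp add: K_mod_def)
  also have "\<dots> = (\<Sum>b\<in>(\<lambda>i. a + var_deg cl i) ` UNIV. \<Sum>i\<in>UNIV. if b = a + var_deg cl i then ?g i else 0)"
    by (intro sum.cong refl) (auto simp: R_diff_def left_gen_zero intro!: sum.cong)
  also have "\<dots> = (\<Sum>i\<in>UNIV. ?g i)"
    by (subst sum.swap) (simp add: sum.delta)
  also have "\<dots> = (\<Sum>i\<in>-J. ?g i)"
    by (intro sum.mono_neutral_right) (auto simp: left_gen_basis[OF t])
  also have "\<dots> = (\<Sum>i\<in>-J. smul (Const ((- 1) ^ Suc (card J))) (smul (shuffle_sign i J * Var i) (\<phi> (ext_basis (insert i J)))))"
  proof (intro sum.cong refl)
    fix i assume "i \<in> - J"
    have "Const (shuffle_sign i J) = (shuffle_sign i J :: ('n, 'k) mpol)"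
    proof -
      have "Const ((- 1 :: 'k) ^ n) = (- 1 :: ('n, 'k) mpol) ^ n" for n
        by (induction n) simp_all
      then show ?thesis by (simp add: shuffle_sign_def)
    qed
    then show "?g i = smul (Const ((- 1) ^ Suc (card J))) (smul (shuffle_sign i J * Var i) (\<phi> (ext_basis (insert i J))))"
      using \<open>i \<in> - J\<close> by (simp add: left_gen_basis[OF t] mult_ac del: power_Suc)
  qed
  finally have "smul (Const ((- 1) ^ Suc (card J))) (\<Sum>i\<in>-J. smul (shuffle_sign i J * Var i) (\<phi> (ext_basis (insert i J)))) = 0"
    by (simp only: S.scale_sum_right)
  then have "smul (Const ((- 1) ^ Suc (card J)) * Const ((- 1) ^ Suc (card J)))
      (\<Sum>i\<in>-J. smul (shuffle_sign i J * Var i) (\<phi> (ext_basis (insert i J)))) = 0"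
    by (simp only: S.scale_zero_right flip: S.scale_scale)
  moreover have "Const ((- 1 :: 'k) ^ Suc (card J)) * Const ((- 1) ^ Suc (card J)) = (1 :: ('n, 'k) mpol)"
    unfolding Const_simps(4)[symmetric] by (simp flip: power_mult_distrib)
  ultimately show ?thesis by simp
qed

end

lemma section_mult_module:
  "Modules.module (act F) \<Longrightarrow> Modules.module (section_mult F)"
  unfolding Modules.module_def section_mult_def by (simp add: fun_eq_iff)

lemma to_ac_map_simps:
  "Poly_Mapping.map to_ac (p + q) = Poly_Mapping.map to_ac p + Poly_Mapping.map to_ac q"
  "Poly_Mapping.map to_ac (p * q) = (Poly_Mapping.map to_ac p * Poly_Mapping.map to_ac q :: ('n::finite, 'k::field alg_closure) mpol)"
  "Poly_Mapping.map to_ac (\<Sum>x\<in>Y. f x) = (\<Sum>x\<in>Y. Poly_Mapping.map to_ac (f x))"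
  "Poly_Mapping.map to_ac (Const c) = Const (to_ac c)" "Poly_Mapping.map to_ac (Var i) = Var i"
  "Poly_Mapping.map to_ac 0 = 0" "Poly_Mapping.map to_ac (1 :: ('n, 'k) mpol) = 1"
  using map_Const[of to_ac "1 :: 'k"]
  by (simp_all add: poly_mapping_map_add poly_mapping_map_mult poly_mapping_map_sum map_Const map_Var poly_mapping_map_zero)

text \<open>Translates the kernel condition into polynomials. \<open>U\<close> plays the role of
  \<open>M a\<close> with basis \<open>L\<close>, and \<open>supp\<close> says that
  \<open>\<phi>\<close> lives in exterior degrees at least \<open>card L\<close>.\<close>

lemma K_mod_vanishing:
  fixes B P :: "('n::{finite,linorder}, 'k::field) mpol set"
    and F :: "(('n, 'k) mpol, 'a, 'm::ab_group_add) esheaf"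
  assumes B: "is_ideal B" and P: "is_prime_ideal P" "nondegenerate P" "geometrically_prime P"
    and F: "qcoh_sheaf B P F" "locally_free B P F"
    and U: "Modules.module.subspace (kscale (section_mult F)) U"
    and s: "\<And>s f. s \<in> U \<Longrightarrow> f \<in> B \<Longrightarrow> s f \<in> sec F f" "\<And>s f. s \<in> U \<Longrightarrow> f \<notin> B \<Longrightarrow> s f = 0"
      "\<And>s f g. s \<in> U \<Longrightarrow> f \<in> B \<Longrightarrow> g \<in> B \<Longrightarrow> f dvd g \<Longrightarrow> res F f g (s f) = s g"
    and L: "L \<subseteq> U" "finite L" "\<not> Modules.module.dependent (kscale (section_mult F)) L"
      "U \<subseteq> Modules.module.span (kscale (section_mult F)) L"
    and \<phi>: "\<phi> \<in> tensor_omega (kscale (section_mult F)) U"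
    and rel: "\<And>J. (\<Sum>i\<in>-J. section_mult F (shuffle_sign i J * Var i) (\<phi> (ext_basis (insert i J)))) = 0"
    and supp: "\<And>I. \<phi> (ext_basis I) \<noteq> 0 \<Longrightarrow> card L \<le> card I"
  shows "\<phi> = 0"
proof (cases "B \<subseteq> P")
  \<comment> \<open>Here \<open>Y\<close> is empty: every \<open>f \<in> B\<close> acts on its
    sections both injectively and as zero.\<close>
  case True
  have "t = 0" if "t \<in> U" for t
  proof
    fix f
    show "t f = 0 f"
    proof (cases "f \<in> B")
      case fB: True
      then have "act F (f ^ 1) (t f) = 0"
        using prime_act_zero[OF F(1) fB _ s(1)[OF that fB]] True by auto
      then have "t f = 0" by (rule sec_power_inj[OF F(1) fB s(1)[OF that fB]])
      then show ?thesis by simp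
    qed (simp add: s(2)[OF that])
  qed
  then show ?thesis using \<phi> by (auto simp: tensor_omega_def fun_eq_iff)
next
  case False
  interpret A: Modules.module "act F" by (rule sheaf_module[OF F(1)])
  interpret S: Modules.module "section_mult F" by (rule section_mult_module[OF A.module_axioms])
  interpret V: vector_space "kscale (section_mult F)" by (rule vector_space_kscale[OF S.module_axioms])
  obtain f Bs where f: "f \<in> B" "f \<notin> P" and Bs: "free_basis P F f Bs"
    using F(2) P(1) False unfolding locally_free_def by blast
  have injU: "t = 0" if "t \<in> U" "t f = 0" for t
  proof
    fix g
    show "t g = 0 g"
      using section_torsion_free[OF F(1) P(1) B F(2) s(1)[OF that(1)] s(3)[OF that(1)] f that(2)] s(2)[OF that(1)]
      by (cases "g \<in> B") simp_all
  qed
  have "\<exists>N h. act F (f ^ N) (l f) = (\<Sum>x\<in>Bs. act F (h x) x)" if "l \<in> L" for l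
    using Bs s(1)[OF _ f(1)] L(1) that unfolding free_basis_def by blast
  then obtain n h0 where n: "\<And>l. l \<in> L \<Longrightarrow> act F (f ^ n l) (l f) = (\<Sum>x\<in>Bs. act F (h0 l x) x)"
    by metis
  \<comment> \<open>One power of \<open>f\<close> clears the denominators of all basis sections at
    once.\<close>
  define N where "N = (\<Sum>l\<in>L. n l)"
  define h where "h l x = f ^ (N - n l) * h0 l x" for l x
  have h: "act F (f ^ N) (l f) = (\<Sum>x\<in>Bs. act F (h l x) x)" if "l \<in> L" for l
  proof -
    have "n l \<le> N" unfolding N_def using that L(2) by (simp add: member_le_sum)
    then have "act F (f ^ N) (l f) = act F (f ^ (N - n l)) (act F (f ^ n l) (l f))"
      by (simp flip: power_add)
    then show ?thesis by (simp add: n[OF that] A.scale_sum_right h_def)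
  qed
  have lin_comb: "act F (f ^ N) ((\<Sum>l\<in>L. kscale (section_mult F) (\<mu> l) l) f)
      = (\<Sum>x\<in>Bs. act F (\<Sum>l\<in>L. Const (\<mu> l) * h l x) x)" for \<mu>
  proof -
    have "act F (f ^ N) ((\<Sum>l\<in>L. kscale (section_mult F) (\<mu> l) l) f)
        = (\<Sum>l\<in>L. act F (Const (\<mu> l)) (act F (f ^ N) (l f)))"
      by (simp add: sum_fun_app kscale_def section_mult_def A.scale_sum_right mult.commute)
    also have "\<dots> = (\<Sum>l\<in>L. \<Sum>x\<in>Bs. act F (Const (\<mu> l) * h l x) x)"
      by (intro sum.cong refl) (simp add: h A.scale_sum_right)
    also have "\<dots> = (\<Sum>x\<in>Bs. act F (\<Sum>l\<in>L. Const (\<mu> l) * h l x) x)"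
      by (subst sum.swap) (simp add: A.scale_sum_left)
    finally show ?thesis .
  qed
  \<comment> \<open>A combination with coordinates in \<open>P\<close> vanishes on
    \<open>D(f)\<close>, hence everywhere, so independence of \<open>L\<close> applies.\<close>
  have ind: "\<forall>l\<in>L. \<mu> l = 0" if \<mu>: "\<And>x. x \<in> Bs \<Longrightarrow> (\<Sum>l\<in>L. Const (\<mu> l) * h l x) \<in> P" for \<mu>
  proof -
    let ?t = "\<Sum>l\<in>L. kscale (section_mult F) (\<mu> l) l"
    have tU: "?t \<in> U"
      using U L(1) by (intro V.subspace_sum V.subspace_scale) auto
    have "act F (\<Sum>l\<in>L. Const (\<mu> l) * h l x) x = 0" if "x \<in> Bs" for x
      using prime_act_zero[OF F(1) f(1) \<mu>[OF that]] Bs that by (auto simp: free_basis_def)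
    then have "act F (f ^ N) (?t f) = 0" by (simp add: lin_comb)
    then have "?t f = 0" by (rule sec_power_inj[OF F(1) f(1) s(1)[OF tU f(1)]])
    then have "?t = 0" by (rule injU[OF tU])
    then show ?thesis using V.independentD[OF L(3,2) order_refl] by blast
  qed
  \<comment> \<open>Coefficients are chosen to vanish wherever \<open>\<phi>\<close> does, so that
    \<open>supp\<close> passes to them directly.\<close>
  have "\<forall>I. \<exists>w. \<phi> (ext_basis I) = (\<Sum>l\<in>L. kscale (section_mult F) (w l) l)
      \<and> (\<phi> (ext_basis I) = 0 \<longrightarrow> (\<forall>l. w l = 0))"
  proof
    fix I
    show "\<exists>w. \<phi> (ext_basis I) = (\<Sum>l\<in>L. kscale (section_mult F) (w l) l)
        \<and> (\<phi> (ext_basis I) = 0 \<longrightarrow> (\<forall>l. w l = 0))"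
    proof (cases "\<phi> (ext_basis I) = 0")
      case False
      have "\<phi> (ext_basis I) \<in> V.span L" using \<phi> L(4) by (auto simp: tensor_omega_def)
      then show ?thesis using False by (auto simp: V.span_finite[OF L(2)])
    qed (auto intro!: exI[of _ "\<lambda>_. 0"])
  qed
  from choice[OF this] obtain w where w': "\<forall>I. \<phi> (ext_basis I) = (\<Sum>l\<in>L. kscale (section_mult F) (w I l) l)
      \<and> (\<phi> (ext_basis I) = 0 \<longrightarrow> (\<forall>l. w I l = 0))" ..
  have w: "\<phi> (ext_basis I) = (\<Sum>l\<in>L. kscale (section_mult F) (w I l) l)" for I
    using spec[OF w', of I] by (rule conjunct1)
  have w0: "w I l = 0" if "\<phi> (ext_basis I) = 0" for I l using w' that by blast
  have contr: "contraction Var (\<lambda>I. \<Sum>l\<in>L. Const (w I l) * h l x) J \<in> P" if x: "x \<in> Bs" for x J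
  proof -
    let ?c = "\<lambda>x. contraction Var (\<lambda>I. \<Sum>l\<in>L. Const (w I l) * h l x) J"
    have "0 = act F (f ^ N) ((\<Sum>i\<in>-J. section_mult F (shuffle_sign i J * Var i) (\<phi> (ext_basis (insert i J)))) f)"
      unfolding rel by simp
    also have "\<dots> = (\<Sum>i\<in>-J. act F (shuffle_sign i J * Var i) (act F (f ^ N) (\<phi> (ext_basis (insert i J)) f)))"
      by (simp add: sum_fun_app section_mult_def A.scale_sum_right mult.commute)
    also have "\<dots> = (\<Sum>i\<in>-J. \<Sum>x\<in>Bs. act F (shuffle_sign i J * Var i * (\<Sum>l\<in>L. Const (w (insert i J) l) * h l x)) x)"
      unfolding w lin_comb by (simp add: A.scale_sum_right)
    also have "\<dots> = (\<Sum>x\<in>Bs. act F (?c x) x)"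
      unfolding contraction_def by (subst sum.swap) (simp add: A.scale_sum_left)
    finally have zero: "(\<Sum>x\<in>Bs. act F (?c x) x) = 0" by (rule sym)
    have "\<forall>c. (\<Sum>x\<in>Bs. act F (c x) x) = 0 \<longrightarrow> (\<forall>x\<in>Bs. \<exists>k. f ^ k * c x \<in> P)"
      using Bs unfolding free_basis_def by (elim conjE)
    from spec[OF this, of ?c] zero x obtain k where "f ^ k * ?c x \<in> P" by blast
    then show ?thesis using f(2) prime_power[OF P(1)] by (auto simp: prime_mult_iff[OF P(1)])
  qed
  let ?P = "ideal_of (Poly_Mapping.map to_ac ` P)"
  have w_zero: "to_ac (w I l) = 0" if "l \<in> L" for I l
  proof (rule contraction_vanishing[where P = ?P and L = L and Bs = Bs
        and h = "\<lambda>l x. Poly_Mapping.map to_ac (h l x)" and w = "\<lambda>l I. to_ac (w I l)"])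
    show "is_prime_ideal ?P" using P(3) by (simp add: geometrically_prime_def)
    show "\<nu> = (\<lambda>_. 0)" if \<nu>: "(\<Sum>i\<in>UNIV. Const (\<nu> i) * Var i) \<in> ?P" for \<nu>
    proof -
      \<comment> \<open>Nondegeneracy is independence of the variables modulo \<open>P\<close>, seen
        as vectors of length one; hence the type \<open>unit\<close>.\<close>
      have "\<forall>i\<in>UNIV. \<nu> i = 0"
        by (rule independent_mod_extended_ideal[OF prime_is_ideal[OF P(1)], where Bs = UNIV and h = "\<lambda>i (_::unit). Var i"])
          (use nondegenerate_linear_form[OF P(2)] \<nu> in \<open>auto simp: to_ac_map_simps\<close>)
      then show ?thesis by auto
    qed
    show "finite L" by fact
    show "\<forall>l\<in>L. \<mu> l = 0"
      if "\<And>x. x \<in> Bs \<Longrightarrow> (\<Sum>l\<in>L. Const (\<mu> l) * Poly_Mapping.map to_ac (h l x)) \<in> ?P" for \<mu>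
      by (rule independent_mod_extended_ideal[OF prime_is_ideal[OF P(1)] ind that])
    show "card L \<le> card I" if "l \<in> L" "to_ac (w I l) \<noteq> 0" for l I
      using supp w0 that by auto
    show "contraction Var (\<lambda>I. \<Sum>l\<in>L. Const (to_ac (w I l)) * Poly_Mapping.map to_ac (h l x)) J \<in> ?P"
      if "x \<in> Bs" for x J
    proof -
      have "Poly_Mapping.map to_ac (contraction Var (\<lambda>I. \<Sum>l\<in>L. Const (w I l) * h l x) J)
          = contraction Var (\<lambda>I. \<Sum>l\<in>L. Const (to_ac (w I l)) * Poly_Mapping.map to_ac (h l x)) J"
        by (subst contraction_hom[of "Poly_Mapping.map to_ac"]) (simp_all add: to_ac_map_simps)
      then show ?thesis
        using ideal_of_superset[OF imageI[OF contr[OF that], of "Poly_Mapping.map to_ac" J]] by (simp only:)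
    qed
  qed (rule that)
  show ?thesis
  proof (rule omega_eq_zero[OF S.module_axioms \<phi>])
    show "\<phi> (ext_basis I) = 0" for I
      unfolding w using w_zero[of _ I] by (intro sum.neutral) (simp add: kscale_def)
  qed
qed

lemma complex_length_le:
  assumes "\<And>j. fst C (int j) \<noteq> {0} \<Longrightarrow> enat j \<le> d"
  shows "complex_length C \<le> d"
  unfolding complex_length_def using assms by (intro SUP_least) auto

theorem corollary6p5:
  fixes Q :: "(real^'d::finite) set"
    and u :: "'n::{finite,linorder} \<Rightarrow> int^'d"
    and cl :: "(int, 'n) vec \<Rightarrow> 'a::ab_group_add"
    and P :: "('n, 'k::field) mpol set"
    and F :: "(('n, 'k) mpol, 'a, 'm::ab_group_add) esheaf"
    and M :: "'a \<Rightarrow> (('n, 'k) mpol \<Rightarrow> 'm) set"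
  assumes "projective_toric Q u cl"
    and "is_prime_ideal P" and "homogeneous_ideal cl P" and "nondegenerate P"
    and "vector_bundle cl (irrelevant_ideal Q u) P F"
    and "graded_submodule cl (section_mult F) M (section_module cl (irrelevant_ideal Q u) F)"
    and "Eff M \<noteq> {}"
  shows "(\<exists>a. minimal_in_Eff TYPE('k) cl M a) \<and>
         (\<forall>a. geometrically_prime P \<longrightarrow> minimal_in_Eff TYPE('k) cl M a \<longrightarrow>
            complex_length (strongly_linear_strand cl (section_mult F) M a)
              \<le> edim (kscale (section_mult F)) (M a) - 1)"
proof (intro conjI allI impI)
  let ?B = "irrelevant_ideal Q u :: ('n, 'k) mpol set" and ?scl = "kscale (section_mult F)"
  have F: "qcoh_sheaf ?B P F" "locally_free ?B P F"
    using assms(5) by (simp_all add: vector_bundle_def)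
  have B: "is_ideal ?B" unfolding irrelevant_ideal_def by (rule is_ideal_ideal_of)
  have cg: "class_group_map u cl" using assms(1) by (simp add: projective_toric_def)
  have M: "M a \<subseteq> section_module cl ?B F a" "0 \<in> M a" "x \<in> M a \<Longrightarrow> y \<in> M a \<Longrightarrow> x + y \<in> M a"
    "p \<in> S_comp cl b \<Longrightarrow> x \<in> M a \<Longrightarrow> section_mult F p x \<in> M (b + a)" for a b p x y
    using assms(6) unfolding graded_submodule_def by blast+
  interpret S: Modules.module "section_mult F"
    by (rule section_mult_module[OF sheaf_module[OF F(1)]])
  interpret V: vector_space ?scl by (rule vector_space_kscale[OF S.module_axioms])
  have EffM: "Eff M \<subseteq> EffS TYPE('k) cl"
    using M(1,2) by (fastforce simp: Eff_def section_module_def split: if_splits)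
  show "\<exists>a. minimal_in_Eff TYPE('k) cl M a"
    by (rule ex_minimal_in_Eff[OF assms(1,7) EffM])
  fix a assume geom: "geometrically_prime P" and "minimal_in_Eff TYPE('k) cl M a"
  then have a: "a \<in> Eff M" "a \<in> EffS TYPE('k) cl" using EffM by (auto simp: minimal_in_Eff_def)
  have subsp: "V.subspace (M a)"
  proof (rule V.subspaceI)
    show "?scl c x \<in> M a" if "x \<in> M a" for c x
      using M(4)[OF _ that, of "Const c" 0] by (simp add: kscale_def S_comp_def Const_def mon_deg_zero[OF cg])
  qed (rule M)+
  have MH: "M a \<subseteq> H0 cl ?B (twist a F)" using M(1)[of a] a(2) by (simp add: section_module_def)
  have sections: "s f \<in> sec F f" if "s \<in> M a" "f \<in> ?B" for s f
    using MH that by (auto simp: H0_def twist_def)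
  have sections_out: "s f = 0" if "s \<in> M a" "f \<notin> ?B" for s f
    using MH that by (auto simp: H0_def)
  have sections_res: "res F f g (s f) = s g" if "s \<in> M a" "f \<in> ?B" "g \<in> ?B" "f dvd g" for s f g
    using MH that by (auto simp: H0_def twist_def)
  show "complex_length (strongly_linear_strand cl (section_mult F) M a) \<le> edim ?scl (M a) - 1"
  proof (cases "\<exists>Bs. finite Bs \<and> Bs \<subseteq> M a \<and> M a \<subseteq> V.span Bs")
    case True
    then obtain Bs where Bs: "finite Bs" "M a \<subseteq> V.span Bs" by blast
    obtain L where L: "L \<subseteq> M a" "V.independent L" "M a \<subseteq> V.span L" "card L = V.dim (M a)"
      using V.basis_exists by blast
    have "finite L" using V.independent_span_bound[OF Bs(1) L(2)] L(1) Bs(2) by blast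
    have "L \<noteq> {}" using L(3) a(1) M(2)[of a] by (auto simp: Eff_def)
    \<comment> \<open>A functional of auxiliary degree \<open>j\<close> is nonzero only on basis
      elements \<open>e\<^sub>I\<close> with \<open>card I = j\<close>.\<close>
    have vanish: "K_comp cl (section_mult F) M a b (int j) \<subseteq> {0}" if j: "card L \<le> j" for b j
    proof
      fix \<phi> assume "\<phi> \<in> K_comp cl (section_mult F) M a b (int j)"
      then have K: "\<phi> \<in> K_mod cl (section_mult F) M a" and deg: "\<phi> \<in> omega_comp cl a b (int j)"
        by (auto simp: K_comp_def)
      have t: "\<phi> \<in> tensor_omega ?scl (M a)" using K by (simp add: K_mod_def)
      have supp: "card L \<le> card I" if "\<phi> (ext_basis I) \<noteq> 0" for I
      proof -
        have "ext_basis I \<in> ext_comp cl (- (\<Sum>i\<in>I. var_deg cl i)) (- int (card I))"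
          by (simp add: ext_comp_def ext_basis_def)
        then show ?thesis using deg that j unfolding omega_comp_def by fastforce
      qed
      have "\<phi> = 0"
      proof (rule K_mod_vanishing[where B = ?B and U = "M a" and L = L and P = P and F = F])
        show "(\<Sum>i\<in>-J. section_mult F (shuffle_sign i J * Var i) (\<phi> (ext_basis (insert i J)))) = 0" for J
          by (rule K_mod_relation[OF S.module_axioms K])
      qed (fact B assms(2,4) geom F subsp L \<open>finite L\<close> t sections sections_out sections_res supp)+
      then show "\<phi> \<in> {0}" by simp
    qed
    \<comment> \<open>The length compares chain modules with \<open>{0}\<close>, so the pieces must
      also be shown to contain \<open>0\<close>.\<close>
    have zeroK: "0 \<in> K_comp cl (section_mult F) M a b j" for b j
    proof -
      interpret E: vector_space "\<lambda>(c::'k) (x::('n, 'k) ext) I. c * x I"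
        by unfold_locales (simp_all add: fun_eq_iff algebra_simps)
      interpret EV: vector_space_pair "\<lambda>(c::'k) (x::('n, 'k) ext) I. c * x I" ?scl ..
      have "(0 :: ('n, 'k, ('n, 'k) mpol \<Rightarrow> 'm) omega) \<in> tensor_omega ?scl (M a)"
        using EV.linear_zero M(2)[of a] by (auto simp: tensor_omega_def zero_fun_def)
      then show ?thesis
        by (auto simp: K_comp_def K_mod_def omega_comp_def R_diff_def fun_eq_iff left_gen_zero cong: if_cong)
    qed
    have "j < card L" if "fst (strongly_linear_strand cl (section_mult F) M a) (int j) \<noteq> {0}" for j
    proof (rule ccontr)
      assume "\<not> j < card L"
      then have "K_comp cl (section_mult F) M a b (int j) = {0}" for b
        using vanish[of j b] zeroK[of b] by auto
      then have "fst (strongly_linear_strand cl (section_mult F) M a) (int j) = {0}"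
        by (auto simp: strongly_linear_strand_def L_complex_def intro!: poly_mapping_eqI)
      then show False using that by blast
    qed
    moreover have "edim ?scl (M a) - 1 = enat (card L - 1)"
      using True L(4) by (simp add: edim_def one_enat_def)
    ultimately show ?thesis by (intro complex_length_le) fastforce
  next
    \<comment> \<open>With \<open>M a\<close> of infinite dimension the bound is
      \<open>\<infinity> - 1 = \<infinity>\<close>.\<close>
    case False
    then have "edim ?scl (M a) = \<infinity>" by (simp only: edim_def if_False)
    then show ?thesis by simp
  qed
qed

end
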